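(* Let $\Phi$ be an irreducible root system of rank $n$ with Weyl group $W$, simple roots $\alpha_1,\dots,\alpha_n$ and fundamental weights $\omega_1,\dots,\omega_n$. Let $u_1,\dots,u_n\ge0$ and $x=u_1\omega_1+\cdots+u_n\omega_n$. The volume $V_\Phi(u_1,\dots,u_n)=\mathrm{Vol}\,P_W(x)$ of the weight polytope $P_W(x)$ is given by $$V_\Phi(u_1,\dots,u_n)=\frac{2^n\cdot|W|}{\prod_{i=1}^n(\alpha_i,\alpha_i)}\sum_T\prod_{j=1}^nf_{\mathrm{desc}(j,T),j}(u),$$ where the sum is over all $\Phi$-trees $T$.
   Context: $\Phi$ is a (reduced, crystallographic) irreducible root system with weight space $\Lambda_{\mathbb{R}}$, Weyl group $W$, and $W$-invariant inner product $(\cdot,\cdot)$. The fundamental weights form the basis dual to the simple coroots $\alpha_i^\vee=2\alpha_i/(\alpha_i,\alpha_i)$. The weight polytope is $P_W(x)=\mathrm{ConvexHull}(w(x)\mid w\in W)$. $\mathrm{Vol}$ is normalized so that the parallelepiped generated by the simple roots has volume $1$. Let $\Gamma$ be the Dynkin diagram of $\Phi$, regarded as a simple graph on the vertex set $[n]=\{1,\dots,n\}$ (edge multiplicities ignored): $i$ and $j$ are adjacent when $i\neq j$ and $(\alpha_i,\alpha_j)\ne0$. For a rooted tree $T$ on $[n]$ and a node $j$, $\mathrm{desc}(j,T)$ is the set of all descendants of $j$ in $T$, including $j$ itself (nodes $i$ such that $j$ lies on the path from $i$ to the root). A $\Phi$-tree is a rooted tree $T$ on the vertex set $[n]$ such that: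 (T1) for every node $i$, with $I=\mathrm{desc}(i,T)$, the induced graph $\Gamma|_I$ is connected; (T2) there are no two nodes $i\ne j$ such that $I=\mathrm{desc}(i,T)$ and $J=\mathrm{desc}(j,T)$ are disjoint and the induced graph $\Gamma|_{I\cup J}$ is connected. For $I\subseteq[n]$, $\Phi_I$ is the root system with simple roots $\{\alpha_i\mid i\in I\}$ and $\omega_i^I$, $i\in I$, are its fundamental weights, i.e. the basis of $\mathrm{span}(\alpha_i\mid i\in I)$ dual to $\{\alpha_i^\vee\mid i\in I\}$ with respect to $(\cdot,\cdot)$. For $j\in I\subseteq[n]$, $f_{I,j}(u)=\frac{1}{|I|}\sum_{i\in I}u_i\,(\omega_i^I,\omega_j^I)$. *)

theory Defs
  imports "HOL-Analysis.Analysis"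
begin

section \<open>Root systems and Weyl groups\<close>

text \<open>The weight space is the ambient type, and its inner product is the \<open>W\<close>-invariant one:
  invariance holds because \<open>W\<close> is generated by orthogonal reflections.\<close>

definition coroot :: "'a::euclidean_space \<Rightarrow> 'a" where
  "coroot a = (2 / (a \<bullet> a)) *\<^sub>R a"

definition reflection :: "'a::euclidean_space \<Rightarrow> 'a \<Rightarrow> 'a" where
  "reflection a v = v - (v \<bullet> coroot a) *\<^sub>R a"

definition root_system :: "'a::euclidean_space set \<Rightarrow> bool" where
  "root_system \<Phi> \<longleftrightarrow>
     finite \<Phi> \<and> 0 \<notin> \<Phi> \<and> span \<Phi> = UNIV \<and>
     (\<forall>a\<in>\<Phi>. reflection a ` \<Phi> = \<Phi>) \<and>
     (\<forall>a\<in>\<Phi>. \<forall>b\<in>\<Phi>. b \<bullet> coroot a \<in> \<int>) \<and>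
     (\<forall>a\<in>\<Phi>. \<forall>c. c *\<^sub>R a \<in> \<Phi> \<longrightarrow> c = 1 \<or> c = -1)"

definition irreducible_root_system :: "'a::euclidean_space set \<Rightarrow> bool" where
  "irreducible_root_system \<Phi> \<longleftrightarrow>
     root_system \<Phi> \<and> \<Phi> \<noteq> {} \<and>
     \<not> (\<exists>A B. A \<noteq> {} \<and> B \<noteq> {} \<and> A \<inter> B = {} \<and> A \<union> B = \<Phi> \<and> (\<forall>a\<in>A. \<forall>b\<in>B. a \<bullet> b = 0))"

definition simple_roots :: "'a::euclidean_space set \<Rightarrow> nat \<Rightarrow> (nat \<Rightarrow> 'a) \<Rightarrow> bool" where
  "simple_roots \<Phi> n \<alpha> \<longleftrightarrow>
     \<alpha> ` {1..n} \<subseteq> \<Phi> \<and> inj_on \<alpha> {1..n} \<and> independent (\<alpha> ` {1..n}) \<and>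
     (\<forall>b\<in>\<Phi>. \<exists>c :: nat \<Rightarrow> nat.
        b = (\<Sum>i=1..n. real (c i) *\<^sub>R \<alpha> i) \<or> b = - (\<Sum>i=1..n. real (c i) *\<^sub>R \<alpha> i))"

text \<open>Reflections are involutions, so the monoid they generate is the group they generate.\<close>

inductive_set weyl_group :: "'a::euclidean_space set \<Rightarrow> ('a \<Rightarrow> 'a) set"
  for \<Phi> :: "'a set" where
  weyl_id: "id \<in> weyl_group \<Phi>"
| weyl_step: "a \<in> \<Phi> \<Longrightarrow> w \<in> weyl_group \<Phi> \<Longrightarrow> reflection a \<circ> w \<in> weyl_group \<Phi>"

definition weight_polytope :: "'a::euclidean_space set \<Rightarrow> 'a \<Rightarrow> 'a set" where
  "weight_polytope \<Phi> x = convex hull {w x | w. w \<in> weyl_group \<Phi>}"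

definition fundamental_weight :: "(nat \<Rightarrow> 'a::euclidean_space) \<Rightarrow> nat set \<Rightarrow> nat \<Rightarrow> 'a" where
  "fundamental_weight \<alpha> I i =
     (THE v. v \<in> span (\<alpha> ` I) \<and> (\<forall>j\<in>I. v \<bullet> coroot (\<alpha> j) = (if i = j then 1 else 0)))"

text \<open>Lebesgue measure rescaled so that the parallelepiped of the simple roots has volume 1.\<close>

definition root_parallelepiped :: "nat \<Rightarrow> (nat \<Rightarrow> 'a::euclidean_space) \<Rightarrow> 'a set" where
  "root_parallelepiped n \<alpha> =
     {(\<Sum>i=1..n. c i *\<^sub>R \<alpha> i) | c. \<forall>i\<in>{1..n}. 0 \<le> c i \<and> c i \<le> 1}"

definition root_volume :: "nat \<Rightarrow> (nat \<Rightarrow> 'a::euclidean_space) \<Rightarrow> 'a set \<Rightarrow> real" where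
  "root_volume n \<alpha> S = measure lebesgue S / measure lebesgue (root_parallelepiped n \<alpha>)"

section \<open>Rooted trees\<close>

text \<open>A rooted tree is a pair of its root and its set of edges, each edge \<open>(i, p)\<close> being oriented
  from the child \<open>i\<close> to its parent \<open>p\<close>. The path from a node to the root is then
  the unique chain of parents starting at that node, so \<open>j\<close> lies on the path from \<open>i\<close>
  to the root iff \<open>(i, j)\<close> is in the reflexive transitive closure of the edge set.\<close>

definition rooted_tree_on :: "'v set \<Rightarrow> 'v \<times> ('v \<times> 'v) set \<Rightarrow> bool" where
  "rooted_tree_on V T \<longleftrightarrow> (case T of (r, E) \<Rightarrow>
     r \<in> V \<and> E \<subseteq> V \<times> V \<and>
     (\<forall>p. (r, p) \<notin> E) \<and>
     (\<forall>i\<in>V - {r}. \<exists>!p. (i, p) \<in> E) \<and>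
     (\<forall>i\<in>V. (i, r) \<in> E\<^sup>*))"

definition desc :: "'v \<Rightarrow> 'v \<times> ('v \<times> 'v) set \<Rightarrow> 'v set" where
  "desc j T = {i. (i, j) \<in> (snd T)\<^sup>*}"

section \<open>The Dynkin diagram and \<open>\<Phi>\<close>-trees\<close>

definition dynkin_adj :: "(nat \<Rightarrow> 'a::euclidean_space) \<Rightarrow> nat \<Rightarrow> nat \<Rightarrow> bool" where
  "dynkin_adj \<alpha> i j \<longleftrightarrow> i \<noteq> j \<and> \<alpha> i \<bullet> \<alpha> j \<noteq> 0"

definition induced_connected :: "('v \<Rightarrow> 'v \<Rightarrow> bool) \<Rightarrow> 'v set \<Rightarrow> bool" where
  "induced_connected adj I \<longleftrightarrow>
     I \<noteq> {} \<and> (\<forall>i\<in>I. \<forall>j\<in>I. (i, j) \<in> {(a, b). a \<in> I \<and> b \<in> I \<and> adj a b}\<^sup>*)"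

definition Phi_tree :: "nat \<Rightarrow> (nat \<Rightarrow> 'a::euclidean_space) \<Rightarrow> nat \<times> (nat \<times> nat) set \<Rightarrow> bool" where
  "Phi_tree n \<alpha> T \<longleftrightarrow>
     rooted_tree_on {1..n} T \<and>
     (\<forall>i\<in>{1..n}. induced_connected (dynkin_adj \<alpha>) (desc i T)) \<and>
     \<not> (\<exists>i\<in>{1..n}. \<exists>j\<in>{1..n}. i \<noteq> j \<and> desc i T \<inter> desc j T = {} \<and>
          induced_connected (dynkin_adj \<alpha>) (desc i T \<union> desc j T))"

lemma finite_Phi_trees: "finite {T. Phi_tree n \<alpha> T}"
proof (rule finite_subset)
  show "{T. Phi_tree n \<alpha> T} \<subseteq> {1..n} \<times> Pow ({1..n} \<times> {1..n})"
    by (auto simp: Phi_tree_def rooted_tree_on_def)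
qed simp

definition tree_factor :: "(nat \<Rightarrow> 'a::euclidean_space) \<Rightarrow> nat set \<Rightarrow> nat \<Rightarrow> (nat \<Rightarrow> real) \<Rightarrow> real" where
  "tree_factor \<alpha> I j u =
     (1 / real (card I)) *
     (\<Sum>i\<in>I. u i * (fundamental_weight \<alpha> I i \<bullet> fundamental_weight \<alpha> I j))"

end

theory Submission
  imports Defs
begin

text \<open>The polytope is the union of the \<open>W\<close>-translates of its part in the dominant chamber, which
  consists of the dominant \<open>y\<close> with \<open>y \<le> x\<close> in the dominance order. Writing
  \<open>y = x - (\<Sum>k. p k *\<^sub>R \<alpha> k)\<close>, this part becomes \<open>Q = {p \<ge> 0. A p \<le> u}\<close> with \<open>A\<close> the Cartan matrix.
  Its facets not containing the point \<open>y = 0\<close> are \<open>{p i = 0}\<close>, each of them a set of the same kind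
  for the index set without \<open>i\<close>, so the decomposition into cones with apex \<open>y = 0\<close> gives
  \<open>n * vol (Q [n]) = (\<Sum>i. z i * vol (Q ([n] - {i})))\<close>, where \<open>z i\<close> is the coordinate \<open>p i\<close> of the
  apex. The sum over \<open>\<Phi>\<close>-trees, extended to forests over arbitrary index sets, satisfies the same
  recursion: delete a root \<open>r\<close> of the forest, whose descendants form the connected component of \<open>r\<close>,
  and use that the component sizes add up to \<open>n\<close>.\<close>

text \<open>The apex coordinate \<open>z I r\<close> is 2/(\<alpha> r, \<alpha> r) times the inner
  product of the dominant weight attached to \<open>I\<close> with the r-th fundamental weight of
  \<open>I\<close>. It depends on \<open>I\<close> through the connected component C of r alone, so
  it equals |C| * 2/(\<alpha> r, \<alpha> r) * f_{C,r}(u): the denominator of f cancels the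
  component size in the recursion for forests, and the factors 2/(\<alpha> j, \<alpha> j) collect to
  the constant in front of the sum. Facets through y = 0 contribute nothing, since a cone over a
  facet containing its apex is flat. Deleting an index may disconnect the diagram, so the claim is
  proved for all subsets of [n]; connectedness returns at the end and turns forests on [n] into
  trees. Volumes are computed by product Lebesgue measure in the root coordinates p, where the
  simple parallelepiped is the unit cube; linear maps are handled by translation invariance instead
  of determinants. As the labels u may vanish, apex coordinates may be 0 and the cone argument
  breaks down; the recursion then holds because both sides are 0.\<close>

declare One_nat_def [simp del]

lemma ex_maximizer:
  fixes f :: "'b \<Rightarrow> 'c::linorder"
  assumes "finite S" "S \<noteq> {}" shows "\<exists>x\<in>S. \<forall>y\<in>S. f y \<le> f x"
proof -
  have "Max (f ` S) \<in> f ` S" using assms by (intro Max_in) auto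
  then obtain x where x: "x \<in> S" "Max (f ` S) = f x" by blast
  have "f y \<le> f x" if "y \<in> S" for y
    unfolding x(2)[symmetric] using assms(1) that by (intro Max_ge) auto
  with x(1) show ?thesis by blast
qed

section \<open>The Weyl group\<close>

text \<open>Existence uses the component \<open>q\<close> of \<alpha> i orthogonal to the other
  vectors, which is nonzero by independence. For uniqueness, the difference of two solutions lies in
  the span and is orthogonal to it.\<close>

lemma ex1_fundamental_weight:
  fixes \<alpha> :: "nat \<Rightarrow> 'a::euclidean_space"
  assumes inj: "inj_on \<alpha> I" and ind: "independent (\<alpha> ` I)" and i: "i \<in> I"
  shows "\<exists>!v. v \<in> span (\<alpha> ` I) \<and> (\<forall>j\<in>I. v \<bullet> coroot (\<alpha> j) = (if i = j then 1 else 0))"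
proof -
  let ?S = "\<alpha> ` (I - {i})"
  have nz: "\<alpha> j \<noteq> 0" if "j \<in> I" for j
    using ind that dependent_zero by (metis image_eqI)
  have img: "?S = \<alpha> ` I - {\<alpha> i}" using inj i by (auto simp: inj_on_def)
  have "\<alpha> i \<notin> span ?S" using ind i unfolding img dependent_def by auto
  moreover obtain p q where pq: "p \<in> span ?S" "\<And>w. w \<in> span ?S \<Longrightarrow> orthogonal q w" "\<alpha> i = p + q"
    using orthogonal_subspace_decomp_exists[of ?S "\<alpha> i"] by metis
  ultimately have q0: "q \<noteq> 0" by auto
  have qi: "q \<bullet> \<alpha> i = q \<bullet> q" using pq by (simp add: inner_add_right orthogonal_def)
  have qj: "q \<bullet> \<alpha> j = 0" if "j \<in> I" "j \<noteq> i" for j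
    using pq(2)[of "\<alpha> j"] that by (simp add: orthogonal_def span_base)
  have qs: "q \<in> span (\<alpha> ` I)"
  proof -
    have "p \<in> span (\<alpha> ` I)" using pq(1) span_mono[of ?S "\<alpha> ` I"] by auto
    moreover have "\<alpha> i \<in> span (\<alpha> ` I)" using i by (simp add: span_base)
    ultimately have "\<alpha> i - p \<in> span (\<alpha> ` I)" by (rule span_diff[rotated])
    then show ?thesis using pq(3) by simp
  qed
  show ?thesis
  proof (rule ex1I)
    \<comment> \<open>The scalar makes the pairing with the i-th coroot equal to 1, because
      \<open>q \<bullet> \<alpha> i = q \<bullet> q\<close>.\<close>
    let ?v = "((\<alpha> i \<bullet> \<alpha> i) / (2 * (q \<bullet> q))) *\<^sub>R q"
    show "?v \<in> span (\<alpha> ` I) \<and> (\<forall>j\<in>I. ?v \<bullet> coroot (\<alpha> j) = (if i = j then 1 else 0))"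
      using qs q0 qi qj nz i by (auto simp: coroot_def span_scale)
    fix v assume v: "v \<in> span (\<alpha> ` I) \<and> (\<forall>j\<in>I. v \<bullet> coroot (\<alpha> j) = (if i = j then 1 else 0))"
    define d where "d = v - ?v"
    have "d \<in> span (\<alpha> ` I)" unfolding d_def using v qs by (intro span_diff span_scale) auto
    moreover have "d \<bullet> \<alpha> j = 0" if "j \<in> I" for j
    proof -
      have "d \<bullet> coroot (\<alpha> j) = 0"
        unfolding d_def inner_diff_left using v that q0 qi qj nz[of i] i nz[of j]
        by (auto simp: coroot_def)
      then show ?thesis using nz[OF that] by (simp add: coroot_def)
    qed
    then have "\<forall>y\<in>\<alpha> ` I. orthogonal d y" by (auto simp: orthogonal_def)
    ultimately have "orthogonal d d" using orthogonal_to_span by blast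
    then show "v = ?v" by (simp add: orthogonal_def d_def)
  qed
qed

lemma fundamental_weight_dual:
  fixes \<alpha> :: "nat \<Rightarrow> 'a::euclidean_space"
  assumes "inj_on \<alpha> I" and "independent (\<alpha> ` I)" and "i \<in> I"
  shows "fundamental_weight \<alpha> I i \<in> span (\<alpha> ` I)"
    and "\<And>j. j \<in> I \<Longrightarrow> fundamental_weight \<alpha> I i \<bullet> coroot (\<alpha> j) = (if i = j then 1 else 0)"
  using theI'[OF ex1_fundamental_weight[OF assms]] unfolding fundamental_weight_def by blast+

lemma linear_reflection: "linear (reflection a)"
  unfolding reflection_def by (intro linearI) (auto simp: algebra_simps)

lemma inner_reflection:
  assumes "a \<noteq> 0" shows "reflection a v \<bullet> reflection a w = v \<bullet> w"
proof -
  let ?c = "v \<bullet> coroot a" and ?d = "w \<bullet> coroot a"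
  have d: "?c * (a \<bullet> a) = 2 * (v \<bullet> a)" using assms by (simp add: coroot_def)
  have e: "?c * (w \<bullet> a) = ?d * (v \<bullet> a)" by (simp add: coroot_def)
  have "reflection a v \<bullet> reflection a w = v \<bullet> w - ?d * (v \<bullet> a) - ?c * (w \<bullet> a) + ?d * (?c * (a \<bullet> a))"
    by (simp add: reflection_def inner_diff_left inner_diff_right inner_commute[of a w] algebra_simps)
  then show ?thesis unfolding d e by simp
qed

lemma reflection_reflection: "reflection a (reflection a v) = v"
  by (cases "a = 0") (auto simp: reflection_def coroot_def algebra_simps inner_diff_left)

lemma reflection_uminus: "reflection (- a) = reflection a"
  by (auto simp: reflection_def coroot_def)

lemma reflection_conj:
  assumes w: "linear w" "\<And>v v'. w v \<bullet> w v' = v \<bullet> v'"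
  shows "reflection (w a) (w v) = w (reflection a v)"
  by (simp add: reflection_def coroot_def w linear_diff linear_scale)

section \<open>Simple roots, their dual basis and positive roots\<close>

locale simple_system =
  fixes \<Phi> :: "'a::euclidean_space set" and n :: nat and \<alpha> :: "nat \<Rightarrow> 'a"
  assumes root_system: "root_system \<Phi>" and simple: "simple_roots \<Phi> n \<alpha>" and rank: "DIM('a) = n"
begin

abbreviation W where "W \<equiv> weyl_group \<Phi>"

lemma simple_root: "i \<in> {1..n} \<Longrightarrow> \<alpha> i \<in> \<Phi>"
  and inj_simple: "inj_on \<alpha> {1..n}"
  and indep_simple: "independent (\<alpha> ` {1..n})"
  using simple by (auto simp: simple_roots_def)

lemma root_nz: "b \<in> \<Phi> \<Longrightarrow> b \<noteq> 0"
  using root_system by (auto simp: root_system_def)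

lemma simple_nz: "i \<in> {1..n} \<Longrightarrow> \<alpha> i \<noteq> 0"
  using root_nz simple_root by blast

lemma reflection_root: "a \<in> \<Phi> \<Longrightarrow> b \<in> \<Phi> \<Longrightarrow> reflection a b \<in> \<Phi>"
  using root_system by (auto simp: root_system_def)

lemma span_simple: "span (\<alpha> ` {1..n}) = UNIV"
  using indep_simple inj_simple rank
  by (simp add: dim_eq_full[symmetric] dim_eq_card_independent card_image)

text \<open>The rescaling turns duality to the coroots into duality to the roots themselves, so
  \<open>v \<bullet> coweight k\<close> is the coefficient of \<alpha> k in v.\<close>

definition coweight :: "nat \<Rightarrow> 'a" where
  "coweight k = (2 / (\<alpha> k \<bullet> \<alpha> k)) *\<^sub>R fundamental_weight \<alpha> {1..n} k"

lemma coweight_dual: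
  assumes "k \<in> {1..n}" "j \<in> {1..n}" shows "\<alpha> j \<bullet> coweight k = (if j = k then 1 else 0)"
  using fundamental_weight_dual(2)[OF inj_simple indep_simple assms] simple_nz[OF assms(2)]
  by (auto simp: coweight_def coroot_def inner_commute field_simps split: if_splits)

lemma coweight_sum:
  "k \<in> {1..n} \<Longrightarrow> (\<Sum>i=1..n. c i *\<^sub>R \<alpha> i) \<bullet> coweight k = c k"
  by (simp add: inner_sum_left coweight_dual if_distrib[where f="\<lambda>x. _ * x"] cong: if_cong)

lemma expand: "v = (\<Sum>i=1..n. (v \<bullet> coweight i) *\<^sub>R \<alpha> i)"
proof -
  have "v \<in> span (\<alpha> ` {1..n})" using span_simple by simp
  then obtain c where c: "v = (\<Sum>a\<in>\<alpha> ` {1..n}. c a *\<^sub>R a)"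
    by (subst (asm) span_finite) auto
  then have v: "v = (\<Sum>i=1..n. c (\<alpha> i) *\<^sub>R \<alpha> i)"
    by (subst (asm) sum.reindex[OF inj_simple]) simp
  show ?thesis
    by (subst v, rule sum.cong) (auto simp: v coweight_sum[of _ "\<lambda>i. c (\<alpha> i)"])
qed

lemma inner_expand: "v \<bullet> w = (\<Sum>i=1..n. (v \<bullet> coweight i) * (\<alpha> i \<bullet> w))"
  by (subst expand[of v]) (simp add: inner_sum_left)

lemma eq_coweightI: "(\<And>k. k \<in> {1..n} \<Longrightarrow> v \<bullet> coweight k = w \<bullet> coweight k) \<Longrightarrow> v = w"
  by (subst expand[of v], subst expand[of w]) (auto intro: sum.cong)

definition pos :: "'a \<Rightarrow> bool" where
  "pos b \<longleftrightarrow> b \<in> \<Phi> \<and> (\<forall>k\<in>{1..n}. b \<bullet> coweight k \<ge> 0)"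

lemma root_cases:
  assumes "b \<in> \<Phi>" shows "pos b \<or> pos (- b)"
proof -
  have "reflection b b = - b" using root_nz[OF assms] by (simp add: reflection_def coroot_def algebra_simps scaleR_2)
  then have mb: "- b \<in> \<Phi>" using reflection_root[OF assms assms] by simp
  obtain c :: "nat \<Rightarrow> nat" where
    "b = (\<Sum>i=1..n. real (c i) *\<^sub>R \<alpha> i) \<or> b = - (\<Sum>i=1..n. real (c i) *\<^sub>R \<alpha> i)"
    using simple assms unfolding simple_roots_def by blast
  then show ?thesis
  proof
    assume b: "b = (\<Sum>i=1..n. real (c i) *\<^sub>R \<alpha> i)"
    have "b \<bullet> coweight k = real (c k)" if "k \<in> {1..n}" for k
      unfolding b using that by (rule coweight_sum)
    then show ?thesis using assms by (auto simp: pos_def)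
  next
    assume "b = - (\<Sum>i=1..n. real (c i) *\<^sub>R \<alpha> i)"
    then have b: "- b = (\<Sum>i=1..n. real (c i) *\<^sub>R \<alpha> i)" by simp
    have "(- b) \<bullet> coweight k = real (c k)" if "k \<in> {1..n}" for k
      unfolding b using that by (rule coweight_sum)
    then have "pos (- b)" using mb unfolding pos_def by (metis of_nat_0_le_iff)
    then show ?thesis ..
  qed
qed

lemma pos_simple: "i \<in> {1..n} \<Longrightarrow> pos (\<alpha> i)"
  by (auto simp: pos_def simple_root coweight_dual)

abbreviation s where "s i \<equiv> reflection (\<alpha> i)"

lemma s_coweight:
  "i \<in> {1..n} \<Longrightarrow> k \<in> {1..n} \<Longrightarrow> k \<noteq> i \<Longrightarrow> s i v \<bullet> coweight k = v \<bullet> coweight k"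
  by (simp add: reflection_def inner_diff_left coweight_dual)

lemma s_coweight_self:
  "i \<in> {1..n} \<Longrightarrow> s i v \<bullet> coweight i = v \<bullet> coweight i - v \<bullet> coroot (\<alpha> i)"
  by (simp add: reflection_def inner_diff_left coweight_dual)

text \<open>The reflection \<open>s i\<close> alters only the coefficient of \<alpha> i, so a
  positive root sent to a negative one has no other coefficient; as the system is reduced, it is
  \<alpha> i itself.\<close>

lemma pos_s:
  assumes b: "pos b" "b \<noteq> \<alpha> i" and i: "i \<in> {1..n}"
  shows "pos (s i b)"
proof (rule ccontr)
  assume n: "\<not> pos (s i b)"
  have bp: "b \<in> \<Phi>" using b by (simp add: pos_def)
  then have "s i b \<in> \<Phi>" using i reflection_root simple_root by blast
  then have "pos (- s i b)" using n root_cases by blast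
  then have "b \<bullet> coweight k = 0" if "k \<in> {1..n}" "k \<noteq> i" for k
    using that b(1) s_coweight[OF i that, of b] unfolding pos_def
    by (metis antisym inner_minus_left neg_0_le_iff_le)
  then have "b \<bullet> coweight k = ((b \<bullet> coweight i) *\<^sub>R \<alpha> i) \<bullet> coweight k" if "k \<in> {1..n}" for k
    using that i by (cases "k = i") (auto simp: coweight_dual)
  then have "b = (b \<bullet> coweight i) *\<^sub>R \<alpha> i" by (rule eq_coweightI)
  then obtain c where e: "b = c *\<^sub>R \<alpha> i" by blast
  then have "c = 1 \<or> c = -1"
    using bp root_system simple_root[OF i] unfolding root_system_def by blast
  moreover have "b \<bullet> coweight i \<ge> 0" using b i by (auto simp: pos_def)
  then have "c \<ge> 0" using e i by (simp add: coweight_dual)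
  ultimately show False using e b(2) by auto
qed

text \<open>By \<open>pos_s\<close> the root \<open>s j (\<alpha> i)\<close> is positive, and its
  \<alpha> j-coefficient is minus the pairing of \<alpha> i with the coroot of \<alpha> j.\<close>

lemma simple_obtuse:
  assumes "i \<in> {1..n}" "j \<in> {1..n}" "i \<noteq> j"
  shows "\<alpha> i \<bullet> \<alpha> j \<le> 0"
proof -
  have "\<alpha> i \<noteq> \<alpha> j" using inj_on_contraD[OF inj_simple assms(3,1,2)] .
  then have "pos (s j (\<alpha> i))" using pos_s[OF pos_simple[OF assms(1)] _ assms(2)] by blast
  then have "s j (\<alpha> i) \<bullet> coweight j \<ge> 0" using assms by (auto simp: pos_def)
  then have "\<alpha> i \<bullet> coroot (\<alpha> j) \<le> 0" using assms by (simp add: s_coweight_self coweight_dual)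
  moreover have "\<alpha> i \<bullet> coroot (\<alpha> j) = 2 / (\<alpha> j \<bullet> \<alpha> j) * (\<alpha> i \<bullet> \<alpha> j)" by (simp add: coroot_def)
  moreover have "2 / (\<alpha> j \<bullet> \<alpha> j) > 0" using simple_nz[OF assms(2)] by simp
  ultimately show ?thesis by (metis linorder_not_le mult_pos_pos)
qed

section \<open>Words in the simple reflections\<close>

primrec word :: "nat list \<Rightarrow> 'a \<Rightarrow> 'a" where
  "word [] = id"
| "word (i # is) = s i \<circ> word is"

lemma word_append: "word (is @ js) = word is \<circ> word js"
  by (induction "is") auto

lemma linear_word: "linear (word is)"
proof (induction "is")
  case Nil
  show ?case unfolding word.simps id_def by (rule linear_ident)
next
  case (Cons i "is")
  then show ?case unfolding word.simps by (intro linear_compose linear_reflection)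
qed

lemma word_rev: "word (rev is) (word is v) = v"
proof (induction "is" arbitrary: v)
  case (Cons i "is")
  then show ?case by (simp add: word_append reflection_reflection)
qed simp

lemma word_rev': "word is (word (rev is) v) = v"
  using word_rev[of "rev is"] by simp

lemma word_inner: "set is \<subseteq> {1..n} \<Longrightarrow> word is v \<bullet> word is w = v \<bullet> w"
proof (induction "is")
  case (Cons i "is")
  then have "\<alpha> i \<noteq> 0" by (intro simple_nz) simp
  with Cons show ?case by (simp add: inner_reflection)
qed simp

lemma word_root:
  assumes b: "b \<in> \<Phi>" shows "set is \<subseteq> {1..n} \<Longrightarrow> word is b \<in> \<Phi>"
proof (induction "is")
  case (Cons i "is")
  then have "i \<in> {1..n}" "word is b \<in> \<Phi>" by simp_all
  then have "s i (word is b) \<in> \<Phi>" by (intro reflection_root simple_root)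
  then show ?case by simp
qed (simp add: b)

text \<open>Induction on a bound for the height. As \<open>b \<bullet> b > 0\<close>, some \<alpha>
  i with positive coefficient has positive inner product with b, and \<open>s i\<close> then lowers
  the height while keeping b positive, unless b is \<alpha> i.\<close>

lemma root_conj_simple_aux:
  assumes "pos b" "(\<Sum>k=1..n. b \<bullet> coweight k) \<le> real h"
  shows "\<exists>is i. set is \<subseteq> {1..n} \<and> i \<in> {1..n} \<and> b = word is (\<alpha> i)"
  using assms
proof (induction h arbitrary: b)
  case 0
  have "b \<bullet> coweight k = 0 \<bullet> coweight k" if "k \<in> {1..n}" for k
  proof -
    have p: "0 \<le> b \<bullet> coweight k" if "k \<in> {1..n}" for k using 0(1) that unfolding pos_def by blast
    have "b \<bullet> coweight k \<le> (\<Sum>k=1..n. b \<bullet> coweight k)"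
      using that by (rule member_le_sum) (use p in auto)
    then show ?thesis using 0(2) p[OF that] by simp
  qed
  then have "b = 0" by (rule eq_coweightI)
  then show ?case using 0 root_nz by (auto simp: pos_def)
next
  case (Suc h)
  have bp: "b \<in> \<Phi>" using Suc by (simp add: pos_def)
  have "0 < b \<bullet> b" using root_nz[OF bp] by simp
  then have "0 < (\<Sum>i=1..n. (b \<bullet> coweight i) * (\<alpha> i \<bullet> b))" unfolding inner_expand[of b b] .
  then obtain i where i: "i \<in> {1..n}" "(b \<bullet> coweight i) * (\<alpha> i \<bullet> b) > 0"
    by (metis (no_types, lifting) linorder_not_le sum_nonpos)
  have "b \<bullet> coweight i \<ge> 0" using Suc.prems(1) i unfolding pos_def by blast
  then have "\<alpha> i \<bullet> b > 0" using i by (simp add: zero_less_mult_iff)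
  then have "b \<bullet> coroot (\<alpha> i) > 0" using simple_nz[OF i(1)] by (simp add: coroot_def inner_commute)
  moreover have "b \<bullet> coroot (\<alpha> i) \<in> \<int>" using root_system simple_root[OF i(1)] bp
    by (auto simp: root_system_def)
  \<comment> \<open>Integrality makes the height drop by at least 1, so the natural number
    \<open>h\<close> can bound it.\<close>
  ultimately have one: "b \<bullet> coroot (\<alpha> i) \<ge> 1" by (auto elim!: Ints_cases)
  show ?case
  proof (cases "b = \<alpha> i")
    case True
    then have "set [] \<subseteq> {1..n} \<and> i \<in> {1..n} \<and> b = word [] (\<alpha> i)" using i by simp
    then show ?thesis by blast
  next
    case False
    have p: "pos (s i b)" using pos_s[OF Suc.prems(1) False i(1)] .
    have "(\<Sum>k=1..n. s i b \<bullet> coweight k) = s i b \<bullet> coweight i + (\<Sum>k\<in>{1..n}-{i}. s i b \<bullet> coweight k)"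
      using i by (simp add: sum.remove)
    also have "\<dots> = b \<bullet> coweight i - b \<bullet> coroot (\<alpha> i) + (\<Sum>k\<in>{1..n}-{i}. b \<bullet> coweight k)"
      using i s_coweight by (simp add: s_coweight_self)
    also have "\<dots> = (\<Sum>k=1..n. b \<bullet> coweight k) - b \<bullet> coroot (\<alpha> i)"
      using i by (simp add: sum.remove)
    finally have "(\<Sum>k=1..n. s i b \<bullet> coweight k) \<le> real h" using one Suc.prems(2) by simp
    from Suc.IH[OF p this] obtain "is" j where
      "set is \<subseteq> {1..n}" "j \<in> {1..n}" "s i b = word is (\<alpha> j)" by blast
    then have "set (i # is) \<subseteq> {1..n}" "j \<in> {1..n}" "b = word (i # is) (\<alpha> j)"
      using i reflection_reflection[of "\<alpha> i" b] by auto
    then show ?thesis by blast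
  qed
qed

lemma pos_root_conj_simple:
  assumes "pos b"
  obtains "is" i where "set is \<subseteq> {1..n}" "i \<in> {1..n}" "b = word is (\<alpha> i)"
  using root_conj_simple_aux[OF assms real_nat_ceiling_ge] by blast

lemma s_word_conj:
  assumes "set is \<subseteq> {1..n}"
  shows "reflection (word is a) \<circ> word is = word is \<circ> reflection a"
  using reflection_conj[OF linear_word word_inner[OF assms]] by auto

text \<open>Every root is, up to sign, some \<open>word is (\<alpha> i)\<close>, and its reflection
  is the conjugate of \<open>s i\<close> by that word.\<close>

lemma reflection_is_word:
  assumes "b \<in> \<Phi>" shows "\<exists>is. set is \<subseteq> {1..n} \<and> reflection b = word is"
proof -
  have *: "\<exists>is. set is \<subseteq> {1..n} \<and> reflection b = word is" if b: "pos b" for b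
  proof -
    obtain "is" i where *: "set is \<subseteq> {1..n}" "i \<in> {1..n}" "b = word is (\<alpha> i)"
      using pos_root_conj_simple[OF b] .
    have "reflection b = reflection b \<circ> word is \<circ> word (rev is)" by (auto simp: word_rev')
    also have "\<dots> = word (is @ [i] @ rev is)"
      using s_word_conj[OF *(1), of "\<alpha> i"] *(3) by (simp add: word_append o_assoc)
    finally show ?thesis using * by (intro exI[of _ "is @ [i] @ rev is"]) auto
  qed
  show ?thesis using root_cases[OF assms] *[of b] *[of "- b"] by (auto simp: reflection_uminus)
qed

lemma weyl_eq_words: "W = word ` {is. set is \<subseteq> {1..n}}"
proof
  show "W \<subseteq> word ` {is. set is \<subseteq> {1..n}}"
  proof
    fix w assume "w \<in> W"
    then show "w \<in> word ` {is. set is \<subseteq> {1..n}}"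
    proof induction
      case weyl_id
      then show ?case by (intro image_eqI[of _ _ "[]"]) auto
    next
      case (weyl_step a w)
      then obtain js "is" where "set is \<subseteq> {1..n}" "reflection a = word is" "set js \<subseteq> {1..n}" "w = word js"
        using reflection_is_word by blast
      then show ?case by (intro image_eqI[of _ _ "is @ js"]) (auto simp: word_append)
    qed
  qed
  have "word is \<in> W" if "set is \<subseteq> {1..n}" for "is"
    using that
  proof (induction "is")
    case (Cons i "is")
    then show ?case using weyl_step[OF simple_root, of i "word is"] by (simp add: o_def)
  qed (simp add: weyl_id)
  then show "word ` {is. set is \<subseteq> {1..n}} \<subseteq> W" by auto
qed

lemma weylE:
  assumes "w \<in> W" obtains "is" where "set is \<subseteq> {1..n}" "w = word is"
  using assms unfolding weyl_eq_words by blast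

lemma word_in_weyl: "set is \<subseteq> {1..n} \<Longrightarrow> word is \<in> W"
  unfolding weyl_eq_words by blast

lemma weyl_inner: "w \<in> W \<Longrightarrow> w v \<bullet> w v' = v \<bullet> v'"
  by (auto elim!: weylE simp: word_inner)

lemma weyl_linear: "w \<in> W \<Longrightarrow> linear w"
  by (auto elim!: weylE simp: linear_word)

lemma weyl_compose: "w \<in> W \<Longrightarrow> w' \<in> W \<Longrightarrow> w \<circ> w' \<in> W"
  by (elim weylE) (simp add: word_append[symmetric] word_in_weyl)

lemma weyl_inverse:
  assumes "w \<in> W"
  obtains w' where "w' \<in> W" "\<And>v. w' (w v) = v" "\<And>v. w (w' v) = v"
  using assms by (elim weylE) (metis set_rev word_in_weyl word_rev word_rev')

lemma finite_weyl: "finite W"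
proof -
  have f: "finite \<Phi>" using root_system by (simp add: root_system_def)
  have "inj_on (\<lambda>w. restrict w \<Phi>) W"
  proof (rule inj_onI)
    fix w w' assume w: "w \<in> W" "w' \<in> W" "restrict w \<Phi> = restrict w' \<Phi>"
    have "w (\<alpha> i) = w' (\<alpha> i)" if "i \<in> {1..n}" for i
      using w(3) simple_root[OF that] by (metis restrict_apply')
    then have "w v = w' v" for v
      using linear_eq_on_span[OF weyl_linear[OF w(1)] weyl_linear[OF w(2)], of "\<alpha> ` {1..n}" v] span_simple
      by (metis UNIV_I imageE)
    then show "w = w'" by auto
  qed
  moreover have "(\<lambda>w. restrict w \<Phi>) ` W \<subseteq> \<Phi> \<rightarrow>\<^sub>E \<Phi>"
    by (auto elim!: weylE simp: word_root)
  moreover have "finite (\<Phi> \<rightarrow>\<^sub>E \<Phi>)" using f by (intro finite_PiE)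
  ultimately show ?thesis by (meson finite_imageD finite_subset)
qed

lemma exchange:
  assumes "set is \<subseteq> {1..n}" "i \<in> {1..n}" "\<not> pos (word is (\<alpha> i))"
  shows "\<exists>js. set js \<subseteq> {1..n} \<and> length js < length is \<and> word is = word js \<circ> s i"
  using assms
proof (induction "is")
  case Nil
  then show ?case by (simp add: pos_simple)
next
  case (Cons j "is")
  show ?case
  proof (cases "pos (word is (\<alpha> i))")
    case False
    moreover have "set is \<subseteq> {1..n}" using Cons.prems by simp
    ultimately obtain js where "set js \<subseteq> {1..n}" "length js < length is" "word is = word js \<circ> s i"
      using Cons.IH Cons.prems(2) by blast
    then show ?thesis using Cons.prems by (intro exI[of _ "j # js"]) (simp add: o_assoc)
  next
    case True
    then have "word is (\<alpha> i) = \<alpha> j"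
      using Cons.prems pos_s[of "word is (\<alpha> i)" j] by auto
    then have "word (j # is) = word is \<circ> s i"
      using s_word_conj[of "is" "\<alpha> i"] Cons.prems by simp
    then show ?thesis using Cons.prems by (intro exI[of _ "is"]) auto
  qed
qed

text \<open>Induction on the length of a shortest word: by \<open>exchange\<close>, such a word cannot end in a
  letter \<open>i\<close> for which \<open>w (\<alpha> i)\<close> is negative.\<close>

lemma weyl_induct [consumes 1, case_names id step]:
  assumes w: "w \<in> W"
    and id: "P id"
    and step: "\<And>w i. w \<in> W \<Longrightarrow> i \<in> {1..n} \<Longrightarrow> pos (w (\<alpha> i)) \<Longrightarrow> P w \<Longrightarrow> P (w \<circ> s i)"
  shows "P w"
proof -
  have "P (word is)" if "set is \<subseteq> {1..n}" for "is"
    using that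
  proof (induction "is" rule: length_induct)
    case (1 "is")
    show ?case
    proof (cases "is" rule: rev_cases)
      case Nil
      then show ?thesis using id by (simp only: word.simps)
    next
      case (snoc js i)
      show ?thesis
      proof (cases "pos (word js (\<alpha> i))")
        case True
        have "P (word js)" using 1 snoc by auto
        then show ?thesis using step[OF word_in_weyl _ True] 1 snoc by (auto simp: word_append o_def)
      next
        case False
        then obtain ks where ks: "set ks \<subseteq> {1..n}" "length ks < length js" "word js = word ks \<circ> s i"
          using exchange[of js i] 1 snoc by auto
        then have "word is = word ks" using snoc by (auto simp: word_append reflection_reflection)
        then show ?thesis using 1 ks snoc by simp
      qed
    qed
  qed
  then show ?thesis using w by (auto elim: weylE)
qed

section \<open>Dominant vectors and the action of the Weyl group on chambers\<close>

definition dom :: "'a \<Rightarrow> bool" where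
  "dom v \<longleftrightarrow> (\<forall>i\<in>{1..n}. v \<bullet> \<alpha> i \<ge> 0)"

lemma dom_coroot: "dom v \<Longrightarrow> i \<in> {1..n} \<Longrightarrow> v \<bullet> coroot (\<alpha> i) \<ge> 0"
  by (simp add: dom_def coroot_def)

text \<open>Passing from \<open>w\<close> to \<open>w \<circ> s i\<close> in
  \<open>weyl_induct\<close> subtracts a nonnegative multiple of the positive root
  \<open>w (\<alpha> i)\<close>, so no coefficient grows.\<close>

lemma weyl_le_dom:
  assumes "w \<in> W" "dom v" "k \<in> {1..n}"
  shows "w v \<bullet> coweight k \<le> v \<bullet> coweight k"
  using assms(1)
proof (induction rule: weyl_induct)
  case (step w i)
  have "(w \<circ> s i) v = w v - (v \<bullet> coroot (\<alpha> i)) *\<^sub>R w (\<alpha> i)"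
    using weyl_linear[OF step(1)] by (simp add: reflection_def linear_diff linear_scale)
  then show ?case using step dom_coroot[OF assms(2)] assms(3)
    by (simp only: inner_diff_left pos_def inner_scaleR_left) (smt (verit) mult_nonneg_nonneg)
qed simp

lemma dom_inner_pos: "dom v \<Longrightarrow> pos b \<Longrightarrow> b \<bullet> v \<ge> 0"
  using inner_expand[of b v]
  by (auto simp: dom_def pos_def inner_commute intro!: sum_nonneg)

text \<open>The induction step is contradictory: \<open>w \<circ> s i\<close> carries \<alpha> i to
  the negative root \<open>- w (\<alpha> i)\<close>, whose pairing with the dominant image of v
  would equal \<open>v \<bullet> \<alpha> i > 0\<close>.\<close>

lemma weyl_simply_transitive:
  assumes "w \<in> W" "\<And>i. i \<in> {1..n} \<Longrightarrow> v \<bullet> \<alpha> i > 0" "dom (w v)"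
  shows "w = id"
  using assms(1,3)
proof (induction rule: weyl_induct)
  case (step w i)
  have "0 < v \<bullet> \<alpha> i" using assms(2) step by blast
  also have "v \<bullet> \<alpha> i = (w \<circ> s i) v \<bullet> (w \<circ> s i) (\<alpha> i)"
    using step by (simp add: weyl_inner inner_reflection simple_nz)
  also have "s i (\<alpha> i) = - \<alpha> i"
    using simple_nz[OF step(2)] by (simp add: reflection_def coroot_def scaleR_2)
  then have "(w \<circ> s i) (\<alpha> i) = - w (\<alpha> i)" using weyl_linear[OF step(1)] by (simp add: linear_neg)
  finally show ?case using dom_inner_pos[OF step.prems step(3)] by (simp add: inner_commute)
qed simp

text \<open>A translate of v that maximizes the pairing with \<rho> is dominant: \<rho> pairs to 1
  with every simple root, so applying \<open>s i\<close> lowers the pairing by exactly that of the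
  translate with the coroot of \<alpha> i.\<close>

lemma ex_dom: "\<exists>w\<in>W. dom (w v)"
proof -
  define \<rho> where "\<rho> = (\<Sum>k=1..n. coweight k)"
  have \<rho>: "\<alpha> i \<bullet> \<rho> = 1" if "i \<in> {1..n}" for i
    using that by (simp add: \<rho>_def inner_sum_right coweight_dual)
  have "W \<noteq> {}" using weyl_id by blast
  then obtain w where w0: "w \<in> W" and w: "\<And>w'. w' \<in> W \<Longrightarrow> w' v \<bullet> \<rho> \<le> w v \<bullet> \<rho>"
    using ex_maximizer[OF finite_weyl, of "\<lambda>w. w v \<bullet> \<rho>"] by blast
  have "dom (w v)" unfolding dom_def
  proof
    fix i assume i: "i \<in> {1..n}"
    have "(s i \<circ> w) v \<bullet> \<rho> \<le> w v \<bullet> \<rho>" using w0 i by (intro w weyl_step simple_root)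
    then have "w v \<bullet> coroot (\<alpha> i) \<ge> 0" using \<rho>[OF i] by (simp add: reflection_def inner_diff_left)
    moreover have "\<alpha> i \<bullet> \<alpha> i > 0" using simple_nz[OF i] by simp
    ultimately show "w v \<bullet> \<alpha> i \<ge> 0"
      by (simp add: coroot_def zero_le_divide_iff zero_le_mult_iff del: inner_gt_zero_iff)
  qed
  then show ?thesis using w0 by blast
qed

text \<open>The inverse Gram matrix of an obtuse basis is nonnegative. If \<open>v1\<close> is the
  part of \<open>v\<close> with negative coefficients and \<open>v2\<close> the rest, then
  \<open>v \<bullet> v1 \<le> 0\<close> by hypothesis and \<open>v2 \<bullet> v1 \<ge> 0\<close> by
  obtuseness, which forces \<open>v1 = 0\<close>; independence then empties
  \<open>N\<close>.\<close>

lemma obtuse_nonneg: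
  assumes I: "I \<subseteq> {1..n}" and pos: "\<And>j. j \<in> I \<Longrightarrow> (\<Sum>k\<in>I. c k * (\<alpha> k \<bullet> \<alpha> j)) \<ge> 0" and k: "k \<in> I"
  shows "c k \<ge> 0"
proof -
  have fin: "finite I" using I finite_subset by blast
  define N where "N = {k\<in>I. c k < 0}"
  define v where "v = (\<Sum>k\<in>I. c k *\<^sub>R \<alpha> k)"
  define v1 where "v1 = (\<Sum>k\<in>N. c k *\<^sub>R \<alpha> k)"
  define v2 where "v2 = (\<Sum>k\<in>I-N. c k *\<^sub>R \<alpha> k)"
  have NI: "N \<subseteq> I" by (auto simp: N_def)
  have v: "v = v2 + v1" unfolding v_def v1_def v2_def using sum.subset_diff[OF NI fin] by simp
  have "v \<bullet> v1 = (\<Sum>j\<in>N. c j * (\<Sum>k\<in>I. c k * (\<alpha> k \<bullet> \<alpha> j)))"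
    by (simp add: v_def v1_def inner_sum_right inner_sum_left)
  also have "\<dots> \<le> 0" by (rule sum_nonpos) (use pos in \<open>auto simp: N_def mult_le_0_iff\<close>)
  finally have 1: "v \<bullet> v1 \<le> 0" .
  have "v2 \<bullet> v1 = (\<Sum>j\<in>N. \<Sum>k\<in>I-N. c k * (c j * (\<alpha> k \<bullet> \<alpha> j)))"
    by (simp add: v2_def v1_def inner_sum_right inner_sum_left sum_distrib_left mult_ac)
  also have "\<dots> \<ge> 0"
  proof (intro sum_nonneg)
    fix j k assume jk: "j \<in> N" "k \<in> I - N"
    then have "\<alpha> k \<bullet> \<alpha> j \<le> 0" using simple_obtuse[of k j] I NI by blast
    then show "c k * (c j * (\<alpha> k \<bullet> \<alpha> j)) \<ge> 0" using jk
      by (intro mult_nonneg_nonneg mult_nonpos_nonpos) (auto simp: N_def)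
  qed
  finally have "v1 \<bullet> v1 \<le> 0" using 1 v by (simp add: inner_add_left)
  then have z: "v1 = 0" using inner_gt_zero_iff[of v1] by linarith
  have N: "N \<subseteq> {1..n}" using NI I by blast
  have "(\<Sum>k=1..n. (if k \<in> N then c k else 0) *\<^sub>R \<alpha> k) = v1"
    unfolding v1_def using N
    by (intro sum.mono_neutral_cong_right) auto
  then have "(\<Sum>k=1..n. (if k \<in> N then c k else 0) *\<^sub>R \<alpha> k) = 0" using z by simp
  then have "(if k \<in> N then c k else 0) = 0" if "k \<in> {1..n}" for k
    using coweight_sum[OF that, of "\<lambda>k. if k \<in> N then c k else 0"] by simp
  then have "k \<notin> N" using N by (metis (mono_tags, lifting) N_def mem_Collect_eq order_less_irrefl subsetD)
  then show ?thesis using k by (auto simp: N_def)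
qed

end

section \<open>Descendant orders of trees\<close>

locale sym_graph =
  fixes adj :: "'v \<Rightarrow> 'v \<Rightarrow> bool"
  assumes adj_sym: "adj a b \<Longrightarrow> adj b a"
begin

abbreviation conn :: "'v set \<Rightarrow> bool" where "conn \<equiv> induced_connected adj"

definition edges :: "'v set \<Rightarrow> ('v \<times> 'v) set" where
  "edges I = {(a, b). a \<in> I \<and> b \<in> I \<and> adj a b}"

definition comp :: "'v set \<Rightarrow> 'v \<Rightarrow> 'v set" where
  "comp I r = {i. (i, r) \<in> (edges I)\<^sup>*}"

lemma conn_iff: "conn I \<longleftrightarrow> I \<noteq> {} \<and> (\<forall>i\<in>I. \<forall>j\<in>I. (i, j) \<in> (edges I)\<^sup>*)"
  by (simp add: induced_connected_def edges_def)

lemma edges_mono: "I \<subseteq> J \<Longrightarrow> (edges I)\<^sup>* \<subseteq> (edges J)\<^sup>*"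
  by (intro rtrancl_mono) (auto simp: edges_def)

lemma edges_sym: "(i, j) \<in> (edges I)\<^sup>* \<Longrightarrow> (j, i) \<in> (edges I)\<^sup>*"
  using sym_rtrancl[of "edges I"] by (auto simp: sym_def edges_def dest: adj_sym)

lemma comp_self: "r \<in> comp I r"
  by (simp add: comp_def)

lemma comp_subset: "r \<in> I \<Longrightarrow> comp I r \<subseteq> I"
  unfolding comp_def by (auto simp: edges_def elim: converse_rtranclE)

lemma conn_subset_comp:
  assumes "conn C" "C \<subseteq> I" "j \<in> C" "j \<in> comp I r"
  shows "C \<subseteq> comp I r"
  using assms edges_mono[OF assms(2)] unfolding conn_iff comp_def
  by (blast intro: rtrancl_trans)

lemma conn_comp: "conn (comp I r)"
proof -
  have *: "(i, r) \<in> (edges (comp I r))\<^sup>*" if "i \<in> comp I r" for i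
    using that unfolding comp_def mem_Collect_eq
  proof (induction rule: converse_rtrancl_induct)
    case (step y z)
    have "(y, r) \<in> (edges I)\<^sup>*" using step by (meson converse_rtrancl_into_rtrancl)
    then have "(y, z) \<in> edges {i. (i, r) \<in> (edges I)\<^sup>*}"
      using step by (auto simp: edges_def)
    then show ?case using step by (meson converse_rtrancl_into_rtrancl)
  qed simp
  show ?thesis unfolding conn_iff
    using * edges_sym comp_self by (metis empty_iff rtrancl_trans)
qed

lemma comp_closed:
  assumes "b \<in> comp I r" "a \<in> I" "b \<in> I" "adj a b" shows "a \<in> comp I r"
  using assms unfolding comp_def by (auto simp: edges_def intro: converse_rtrancl_into_rtrancl)

lemma conn_Un:
  assumes A: "conn A" and B: "conn B" and ab: "a \<in> A" "b \<in> B" "adj a b"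
  shows "conn (A \<union> B)"
proof -
  have 1: "(i, j) \<in> (edges (A \<union> B))\<^sup>*" if "i \<in> A" "j \<in> A" for i j
    using A that edges_mono[of A "A \<union> B"] unfolding conn_iff by blast
  have 2: "(i, j) \<in> (edges (A \<union> B))\<^sup>*" if "i \<in> B" "j \<in> B" for i j
    using B that edges_mono[of B "A \<union> B"] unfolding conn_iff by blast
  have 3: "(a, b) \<in> (edges (A \<union> B))\<^sup>*" using ab by (auto simp: edges_def)
  have "(i, b) \<in> (edges (A \<union> B))\<^sup>*" if "i \<in> A \<union> B" for i
    using that 1[OF _ ab(1)] 2[OF _ ab(2)] 3 by (auto intro: rtrancl_trans)
  then have "(i, j) \<in> (edges (A \<union> B))\<^sup>*" if "i \<in> A \<union> B" "j \<in> A \<union> B" for i j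
    using that rtrancl_trans[OF _ edges_sym] by metis
  then show ?thesis unfolding conn_iff using ab(1) by blast
qed

definition below :: "('v \<times> 'v) set \<Rightarrow> 'v \<Rightarrow> 'v set" where
  "below R j = {i. (i, j) \<in> R}"

text \<open>A \<open>\<Phi>\<close>-tree is encoded by its descendant order. Unlike trees, the orders below may have
  several maximal elements, so that the class is closed under deleting a maximal element.\<close>

definition forest_order :: "'v set \<Rightarrow> ('v \<times> 'v) set \<Rightarrow> bool" where
  "forest_order I R \<longleftrightarrow> R \<subseteq> I \<times> I \<and> (\<forall>i\<in>I. (i, i) \<in> R) \<and> antisym R \<and> trans R \<and>
     (\<forall>i j k. (i, j) \<in> R \<longrightarrow> (i, k) \<in> R \<longrightarrow> (j, k) \<in> R \<or> (k, j) \<in> R) \<and>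
     (\<forall>j\<in>I. conn (below R j)) \<and>
     (\<forall>i\<in>I. \<forall>j\<in>I. i \<noteq> j \<longrightarrow> below R i \<inter> below R j = {} \<longrightarrow> \<not> conn (below R i \<union> below R j))"

definition maxel :: "'v set \<Rightarrow> ('v \<times> 'v) set \<Rightarrow> 'v \<Rightarrow> bool" where
  "maxel I R r \<longleftrightarrow> r \<in> I \<and> (\<forall>j. (r, j) \<in> R \<longrightarrow> j = r)"

lemma forest_orderD:
  assumes "forest_order I R"
  shows "R \<subseteq> I \<times> I" "\<And>i. i \<in> I \<Longrightarrow> (i, i) \<in> R" "antisym R" "trans R"
    "\<And>i j k. (i, j) \<in> R \<Longrightarrow> (i, k) \<in> R \<Longrightarrow> (j, k) \<in> R \<or> (k, j) \<in> R"
    "\<And>j. j \<in> I \<Longrightarrow> conn (below R j)"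
    "\<And>i j. i \<in> I \<Longrightarrow> j \<in> I \<Longrightarrow> i \<noteq> j \<Longrightarrow> below R i \<inter> below R j = {} \<Longrightarrow> \<not> conn (below R i \<union> below R j)"
proof -
  have 1: "R \<subseteq> I \<times> I" and 2: "\<forall>i\<in>I. (i, i) \<in> R" and 3: "antisym R" and 4: "trans R"
    and 5: "\<forall>i j k. (i, j) \<in> R \<longrightarrow> (i, k) \<in> R \<longrightarrow> (j, k) \<in> R \<or> (k, j) \<in> R"
    and 6: "\<forall>j\<in>I. conn (below R j)"
    and 7: "\<forall>i\<in>I. \<forall>j\<in>I. i \<noteq> j \<longrightarrow> below R i \<inter> below R j = {} \<longrightarrow> \<not> conn (below R i \<union> below R j)"
    using assms unfolding forest_order_def by - (elim conjE, assumption)+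
  show "R \<subseteq> I \<times> I" "antisym R" "trans R" by fact+
  show "(i, i) \<in> R" if "i \<in> I" for i
    using 2[rule_format, OF that] .
  show "(j, k) \<in> R \<or> (k, j) \<in> R" if "(i, j) \<in> R" "(i, k) \<in> R" for i j k
    using 5[rule_format, OF that] .
  show "conn (below R j)" if "j \<in> I" for j
    using 6[rule_format, OF that] .
  show "\<not> conn (below R i \<union> below R j)" if "i \<in> I" "j \<in> I" "i \<noteq> j" "below R i \<inter> below R j = {}" for i j
    using 7[rule_format, OF that] .
qed

lemma finite_forest_orders: "finite I \<Longrightarrow> finite {R. forest_order I R}"
  by (rule finite_subset[of _ "Pow (I \<times> I)"]) (auto simp: forest_order_def)

lemma below_subset: "forest_order I R \<Longrightarrow> below R j \<subseteq> I"
  by (auto simp: forest_order_def below_def)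

lemma ex_maxel:
  assumes I: "finite I" and R: "forest_order I R" and i: "i \<in> I"
  shows "\<exists>m. maxel I R m \<and> (i, m) \<in> R"
proof -
  let ?U = "{j. (i, j) \<in> R}"
  note D = forest_orderD[OF R]
  have "finite ?U" using I by (rule rev_finite_subset) (use D(1) in auto)
  moreover have "?U \<noteq> {}" using D(2)[OF i] by auto
  ultimately obtain m where m: "m \<in> ?U" "\<And>j. j \<in> ?U \<Longrightarrow> card (below R j) \<le> card (below R m)"
    using ex_maximizer[of ?U "\<lambda>j. card (below R j)"] by blast
  have "j = m" if mj: "(m, j) \<in> R" for j
  proof (rule ccontr)
    assume ne: "j \<noteq> m"
    have "j \<in> I" using mj D(1) by auto
    have "below R m \<subseteq> below R j" using mj D(4) by (auto simp: below_def dest: transD)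
    moreover have "j \<in> below R j" "j \<notin> below R m"
      using D(2)[OF \<open>j \<in> I\<close>] D(3) mj ne by (auto simp: below_def dest: antisymD)
    ultimately have "below R m \<subset> below R j" by blast
    moreover have "finite (below R j)" using below_subset[OF R] I by (rule finite_subset)
    ultimately have "card (below R m) < card (below R j)" by (simp add: psubset_card_mono)
    moreover have "(i, j) \<in> R" using m(1) mj D(4) by (auto dest: transD)
    ultimately show False using m(2)[of j] by simp
  qed
  then show ?thesis using m(1) D(1) by (auto simp: maxel_def)
qed

lemma maxel_disjoint:
  assumes R: "forest_order I R" and "maxel I R r" "maxel I R m" "r \<noteq> m"
  shows "below R r \<inter> below R m = {}"
  using forest_orderD(5)[OF R] assms(2-4) by (fastforce simp: below_def maxel_def)

text \<open>Connectedness keeps the down-set inside the component. A neighbour outside it would lie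
  below another maximal element, whose disjoint down-set would have a connected union with that of
  r, against (T2). So the descendants of a root are forced by the graph.\<close>

lemma below_maxel:
  assumes I: "finite I" and R: "forest_order I R" and r: "maxel I R r"
  shows "below R r = comp I r"
proof
  note D = forest_orderD[OF R]
  have rI: "r \<in> I" using r by (simp add: maxel_def)
  show "below R r \<subseteq> comp I r"
    using D(6)[OF rI] below_subset[OF R] D(2)[OF rI] comp_self
    by (intro conn_subset_comp[of _ _ r]) (auto simp: below_def)
  have closed: "a \<in> below R r" if "b \<in> below R r" "a \<in> I" "adj a b" for a b
  proof (rule ccontr)
    assume a: "a \<notin> below R r"
    obtain m where m: "maxel I R m" "(a, m) \<in> R" using ex_maxel[OF I R \<open>a \<in> I\<close>] by blast
    have mr: "m \<noteq> r" using a m by (auto simp: below_def)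
    have "conn (below R m \<union> below R r)"
      using m that D(6) rI by (intro conn_Un[of _ _ a b]) (auto simp: below_def maxel_def)
    moreover have "below R m \<inter> below R r = {}" using maxel_disjoint[OF R m(1) r mr] .
    ultimately show False using D(7)[of m r] m(1) rI mr by (auto simp: maxel_def)
  qed
  show "comp I r \<subseteq> below R r"
  proof
    fix i assume "i \<in> comp I r"
    then have "(i, r) \<in> (edges I)\<^sup>*" by (simp add: comp_def)
    then show "i \<in> below R r"
    proof (induction rule: converse_rtrancl_induct)
      case base
      show ?case using D(2)[OF rI] by (simp add: below_def)
    next
      case (step y z)
      then show ?case using closed[of z y] by (auto simp: edges_def)
    qed
  qed
qed

lemma card_eq_sum_below:
  assumes I: "finite I" and R: "forest_order I R"
  shows "card I = (\<Sum>r\<in>{r\<in>I. maxel I R r}. card (below R r))"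
proof -
  have "I = (\<Union>r\<in>{r\<in>I. maxel I R r}. below R r)"
    using ex_maxel[OF I R] below_subset[OF R] by (fastforce simp: below_def maxel_def)
  then have "card I = card (\<Union>r\<in>{r\<in>I. maxel I R r}. below R r)" by simp
  also have "\<dots> = (\<Sum>r\<in>{r\<in>I. maxel I R r}. card (below R r))"
    using I maxel_disjoint[OF R] finite_subset[OF below_subset[OF R] I]
    by (intro card_UN_disjoint) auto
  finally show ?thesis .
qed

lemma forest_order_delete:
  assumes R: "forest_order I R" and r: "maxel I R r"
  shows "forest_order (I - {r}) (R \<inter> (I - {r}) \<times> (I - {r}))" (is "forest_order ?J ?R")
    and "\<And>j. j \<in> I - {r} \<Longrightarrow> below (R \<inter> (I - {r}) \<times> (I - {r})) j = below R j"
proof -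
  note D = forest_orderD[OF R]
  show b: "below ?R j = below R j" if "j \<in> ?J" for j
    using that r D(1) by (auto simp: below_def maxel_def)
  show "forest_order ?J ?R"
    unfolding forest_order_def
  proof (intro conjI ballI allI impI)
    show "antisym ?R" using D(3) by (auto simp: antisym_def)
    show "trans ?R" using D(4) unfolding trans_def by blast
    show "(j, k) \<in> ?R \<or> (k, j) \<in> ?R" if "(i, j) \<in> ?R" "(i, k) \<in> ?R" for i j k
      using D(5)[of i j k] that by blast
  qed (use D b in auto)
qed

text \<open>Inverse of deletion: r is put above its component and nothing else. Connectedness of the
  old down-sets makes the component closed downwards (\<open>up\<close>) and upwards
  (\<open>down\<close>), which yields transitivity and comparability; (T2) for r holds because a
  connected set containing r stays inside its component.\<close>

lemma forest_order_insert:
  assumes R: "forest_order (I - {r}) R" and r: "r \<in> I"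
  shows "forest_order I (R \<union> comp I r \<times> {r})" (is "forest_order I ?R")
    and "maxel I (R \<union> comp I r \<times> {r}) r"
proof -
  note D = forest_orderD[OF R]
  have b: "below ?R j = below R j" if "j \<noteq> r" for j
    using that by (auto simp: below_def)
  have br: "below ?R r = comp I r"
    using D(1) by (auto simp: below_def)
  have CI: "comp I r \<subseteq> I" by (rule comp_subset[OF r])
  have nr: "(r, j) \<notin> R" "(j, r) \<notin> R" for j using D(1) by auto
  have up: "below R j \<subseteq> comp I r" if "j \<in> comp I r" "j \<noteq> r" for j
  proof (rule conn_subset_comp[of _ _ j])
    have j: "j \<in> I - {r}" using that CI by blast
    show "conn (below R j)" using D(6)[OF j] .
    show "below R j \<subseteq> I" using below_subset[OF R] by blast
    show "j \<in> below R j" using D(2)[OF j] by (simp add: below_def)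
  qed (rule that)
  have down: "j \<in> comp I r" if "(i, j) \<in> R" "i \<in> comp I r" for i j
  proof -
    have j: "j \<in> I - {r}" using that D(1) by auto
    have "below R j \<subseteq> comp I r"
      using D(6)[OF j] below_subset[OF R] that
      by (intro conn_subset_comp[of _ _ i]) (auto simp: below_def)
    then show ?thesis using D(2)[OF j] by (auto simp: below_def)
  qed
  show "maxel I ?R r" using r nr by (auto simp: maxel_def)
  have rest: "\<not> conn (below R i \<union> comp I r)" if i: "i \<in> I" "i \<noteq> r" "below R i \<inter> comp I r = {}" for i
  proof
    have iJ: "i \<in> I - {r}" using i by simp
    assume c: "conn (below R i \<union> comp I r)"
    have "below R i \<union> comp I r \<subseteq> comp I r"
      using below_subset[OF R] CI comp_self
      by (intro conn_subset_comp[OF c, of _ r]) auto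
    then have "below R i = {}" using i(3) by blast
    then show False using D(2)[OF iJ] by (auto simp: below_def)
  qed
  show "forest_order I ?R"
    unfolding forest_order_def
  proof (intro conjI ballI allI impI)
    show "?R \<subseteq> I \<times> I" using D(1) CI r by auto
    show "(i, i) \<in> ?R" if "i \<in> I" for i using D(2)[of i] that comp_self by (cases "i = r") auto
    show "antisym ?R" using D(3) nr unfolding antisym_def by blast
    show "trans ?R"
    proof (rule transI)
      fix x y z assume xy: "(x, y) \<in> ?R" and yz: "(y, z) \<in> ?R"
      consider "(x, y) \<in> R" "(y, z) \<in> R" | "(x, y) \<in> R" "y \<in> comp I r" "z = r" | "y = r" "z = r" "x \<in> comp I r"
        using xy yz nr by auto
      then show "(x, z) \<in> ?R"
      proof cases
        case 1
        then show ?thesis using transD[OF D(4)] by blast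
      next
        case 2
        then show ?thesis using up[of y] nr by (auto simp: below_def)
      qed auto
    qed
    show "(j, k) \<in> ?R \<or> (k, j) \<in> ?R" if "(i, j) \<in> ?R" "(i, k) \<in> ?R" for i j k
      using that D(5)[of i j k] down comp_self by blast
    show "conn (below ?R j)" if "j \<in> I" for j
      using D(6)[of j] that b[of j] br conn_comp by (cases "j = r") auto
    show "\<not> conn (below ?R i \<union> below ?R j)"
      if ij: "i \<in> I" "j \<in> I" "i \<noteq> j" "below ?R i \<inter> below ?R j = {}" for i j
    proof -
      consider "i = r" "j \<noteq> r" | "i \<noteq> r" "j = r" | "i \<noteq> r" "j \<noteq> r" using ij(3) by blast
      then show ?thesis
      proof cases
        case 1
        then show ?thesis using rest[of j] ij by (simp add: b br Un_commute Int_commute)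
      next
        case 2
        then show ?thesis using rest[of i] ij by (simp add: b br)
      next
        case 3
        then show ?thesis using D(7)[of i j] ij by (simp add: b)
      qed
    qed
  qed
qed

text \<open>By \<open>below_maxel\<close> the pairs deleted along with r are exactly
  \<open>comp I r \<times> {r}\<close>, so they can be restored without knowing the order.\<close>

lemma bij_forest_order:
  assumes I: "finite I" and r: "r \<in> I"
  shows "bij_betw (\<lambda>R. R \<inter> (I - {r}) \<times> (I - {r})) {R. forest_order I R \<and> maxel I R r}
           {R. forest_order (I - {r}) R}"
proof (rule bij_betw_byWitness[where f' = "\<lambda>R. R \<union> comp I r \<times> {r}"])
  let ?J = "I - {r}"
  show "\<forall>R\<in>{R. forest_order I R \<and> maxel I R r}. R \<inter> ?J \<times> ?J \<union> comp I r \<times> {r} = R"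
  proof
    fix R assume "R \<in> {R. forest_order I R \<and> maxel I R r}"
    then have R: "forest_order I R" "maxel I R r" by auto
    have e: "(a, r) \<in> R \<longleftrightarrow> a \<in> comp I r" for a
      using below_maxel[OF I R] by (auto simp: below_def)
    have s: "b \<noteq> r \<Longrightarrow> (r, b) \<notin> R" for b using R(2) by (auto simp: maxel_def)
    have "(a, b) \<in> R \<inter> ?J \<times> ?J \<union> comp I r \<times> {r} \<longleftrightarrow> (a, b) \<in> R" for a b
      using e s forest_orderD(1)[OF R(1)] by (cases "b = r"; cases "a = r") auto
    then show "R \<inter> ?J \<times> ?J \<union> comp I r \<times> {r} = R" by auto
  qed
  show "\<forall>R\<in>{R. forest_order ?J R}. (R \<union> comp I r \<times> {r}) \<inter> ?J \<times> ?J = R"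
    using forest_orderD(1) by fastforce
  show "(\<lambda>R. R \<inter> ?J \<times> ?J) ` {R. forest_order I R \<and> maxel I R r} \<subseteq> {R. forest_order ?J R}"
    using forest_order_delete(1) by blast
  show "(\<lambda>R. R \<union> comp I r \<times> {r}) ` {R. forest_order ?J R} \<subseteq> {R. forest_order I R \<and> maxel I R r}"
    using forest_order_insert r by blast
qed

definition forest_sum :: "('v set \<Rightarrow> 'v \<Rightarrow> real) \<Rightarrow> 'v set \<Rightarrow> real" where
  "forest_sum F I = (\<Sum>R\<in>{R. forest_order I R}. \<Prod>j\<in>I. F (below R j) j)"

lemma forest_sum_empty: "forest_sum F {} = 1"
proof -
  have "{R. forest_order {} R} = {{}}" by (auto simp: forest_order_def)
  then show ?thesis by (simp add: forest_sum_def)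
qed

text \<open>Distribute the factor \<open>card I\<close> over the maximal elements of each forest order, and delete
  the maximal element.\<close>

lemma forest_sum_rec:
  assumes I: "finite I"
  shows "real (card I) * forest_sum F I =
    (\<Sum>r\<in>I. real (card (comp I r)) * F (comp I r) r * forest_sum F (I - {r}))"
proof -
  let ?P = "\<lambda>R. \<Prod>j\<in>I. F (below R j) j"
  have "real (card I) * forest_sum F I = (\<Sum>R\<in>{R. forest_order I R}. real (card I) * ?P R)"
    by (simp add: forest_sum_def sum_distrib_left)
  also have "\<dots> = (\<Sum>R\<in>{R. forest_order I R}. \<Sum>r\<in>{r\<in>I. maxel I R r}. real (card (below R r)) * ?P R)"
    by (rule sum.cong[OF refl], subst card_eq_sum_below[OF I]) (simp_all add: sum_distrib_right)
  also have "\<dots> = (\<Sum>r\<in>I. \<Sum>R\<in>{R \<in> {R. forest_order I R}. maxel I R r}. real (card (below R r)) * ?P R)"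
    by (rule sum.swap_restrict[OF finite_forest_orders[OF I] I])
  also have "\<dots> = (\<Sum>r\<in>I. real (card (comp I r)) * F (comp I r) r * forest_sum F (I - {r}))"
  proof (rule sum.cong[OF refl])
    fix r assume r: "r \<in> I"
    let ?J = "I - {r}"
    have "(\<Sum>R\<in>{R \<in> {R. forest_order I R}. maxel I R r}. real (card (below R r)) * ?P R) =
        (\<Sum>R\<in>{R. forest_order I R \<and> maxel I R r}. real (card (comp I r)) * F (comp I r) r *
           (\<Prod>j\<in>?J. F (below (R \<inter> ?J \<times> ?J) j) j))"
    proof (rule sum.cong)
      fix R assume "R \<in> {R. forest_order I R \<and> maxel I R r}"
      then have R: "forest_order I R" "maxel I R r" by auto
      have "?P R = F (below R r) r * (\<Prod>j\<in>?J. F (below R j) j)" using I r by (simp add: prod.remove)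
      then show "real (card (below R r)) * ?P R =
          real (card (comp I r)) * F (comp I r) r * (\<Prod>j\<in>?J. F (below (R \<inter> ?J \<times> ?J) j) j)"
        using forest_order_delete(2)[OF R] by (simp add: below_maxel[OF I R])
    qed auto
    also have "\<dots> = (\<Sum>R\<in>{R. forest_order ?J R}. real (card (comp I r)) * F (comp I r) r *
           (\<Prod>j\<in>?J. F (below R j) j))"
      by (rule sum.reindex_bij_betw[OF bij_forest_order[OF I r]])
    finally show "(\<Sum>R\<in>{R \<in> {R. forest_order I R}. maxel I R r}. real (card (below R r)) * ?P R) =
        real (card (comp I r)) * F (comp I r) r * forest_sum F ?J"
      by (simp add: forest_sum_def sum_distrib_left)
  qed
  finally show ?thesis .
qed

section \<open>Rooted trees and their descendant orders\<close>

definition connected_tree :: "'v set \<Rightarrow> 'v \<times> ('v \<times> 'v) set \<Rightarrow> bool" where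
  "connected_tree V T \<longleftrightarrow> rooted_tree_on V T \<and> (\<forall>i\<in>V. conn (desc i T)) \<and>
     \<not> (\<exists>i\<in>V. \<exists>j\<in>V. i \<noteq> j \<and> desc i T \<inter> desc j T = {} \<and> conn (desc i T \<union> desc j T))"

text \<open>The intersection removes the pairs (i, i) with i outside \<open>V\<close>, which the
  reflexive closure over the whole type contains.\<close>

definition tree_order :: "'v set \<Rightarrow> 'v \<times> ('v \<times> 'v) set \<Rightarrow> ('v \<times> 'v) set" where
  "tree_order V T = (snd T)\<^sup>* \<inter> V \<times> V"

text \<open>The root is the greatest element, and the parent of i is the least element strictly
  above i.\<close>

definition order_tree :: "'v set \<Rightarrow> ('v \<times> 'v) set \<Rightarrow> 'v \<times> ('v \<times> 'v) set" where
  "order_tree V R = ((THE r. r \<in> V \<and> (\<forall>i\<in>V. (i, r) \<in> R)),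
     {(i, p). (i, p) \<in> R \<and> i \<noteq> p \<and> (\<forall>q. (i, q) \<in> R \<longrightarrow> q \<noteq> i \<longrightarrow> (p, q) \<in> R)})"

context
  fixes V :: "'v set" and r :: 'v and E :: "('v \<times> 'v) set"
  assumes tree: "rooted_tree_on V (r, E)"
begin

lemma treeD:
  "r \<in> V" "E \<subseteq> V \<times> V" "\<And>p. (r, p) \<notin> E" "\<And>i. i \<in> V \<Longrightarrow> (i, r) \<in> E\<^sup>*"
  using tree by (auto simp: rooted_tree_on_def)

lemma tree_sv: "single_valued E"
  using tree treeD(2,3) unfolding single_valued_def rooted_tree_on_def by blast

text \<open>Induction along the path to the root, which has no outgoing edge. Since parents are
  unique, a cycle through a node also passes through its parent.\<close>

lemma tree_acyclic: "(i, i) \<notin> E\<^sup>+"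
proof (cases "i \<in> V")
  case True
  from treeD(4)[OF True] show ?thesis
  proof (induction rule: converse_rtrancl_induct)
    case base
    show ?case using treeD(3) by (auto dest: tranclD)
  next
    case (step y z)
    show ?case
    proof
      assume "(y, y) \<in> E\<^sup>+"
      then obtain p where "(y, p) \<in> E" "(p, y) \<in> E\<^sup>*" by (auto dest: tranclD)
      then have "(z, y) \<in> E\<^sup>*" using step(1) tree_sv by (metis single_valuedD)
      then have "(z, z) \<in> E\<^sup>+" using step(1) by (rule rtrancl_into_trancl1)
      then show False using step.IH by blast
    qed
  qed
next
  case False
  then show ?thesis using treeD(2) by (auto dest: tranclD)
qed

lemma tree_antisym: "(i, j) \<in> E\<^sup>* \<Longrightarrow> (j, i) \<in> E\<^sup>* \<Longrightarrow> i = j"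
  using tree_acyclic by (metis rtranclD trancl_rtrancl_trancl)

lemma tree_first_step:
  "(i, p) \<in> E \<Longrightarrow> (i, q) \<in> E\<^sup>* \<Longrightarrow> q \<noteq> i \<Longrightarrow> (p, q) \<in> E\<^sup>*"
  using tree_sv by (metis converse_rtranclE single_valuedD)

lemma desc_tree: "j \<in> V \<Longrightarrow> desc j (r, E) = below (tree_order V (r, E)) j"
  using treeD(2) by (auto simp: desc_def below_def tree_order_def elim: converse_rtranclE)

lemma order_tree_tree_order: "order_tree V (tree_order V (r, E)) = (r, E)"
proof -
  have 1: "(THE m. m \<in> V \<and> (\<forall>i\<in>V. (i, m) \<in> tree_order V (r, E))) = r"
    using treeD(1,4) tree_antisym by (intro the_equality) (auto simp: tree_order_def)
  let ?R = "tree_order V (r, E)"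
  have "(i, p) \<in> ?R \<and> i \<noteq> p \<and> (\<forall>q. (i, q) \<in> ?R \<longrightarrow> q \<noteq> i \<longrightarrow> (p, q) \<in> ?R) \<longleftrightarrow> (i, p) \<in> E" for i p
  proof
    assume *: "(i, p) \<in> ?R \<and> i \<noteq> p \<and> (\<forall>q. (i, q) \<in> ?R \<longrightarrow> q \<noteq> i \<longrightarrow> (p, q) \<in> ?R)"
    then have ip: "(i, p) \<in> E\<^sup>*" "i \<in> V" "i \<noteq> p" by (auto simp: tree_order_def)
    obtain q where q: "(i, q) \<in> E" "(q, p) \<in> E\<^sup>*" using ip by (auto elim: converse_rtranclE)
    then have "q \<noteq> i" "(i, q) \<in> ?R" using tree_acyclic treeD(2) by (auto simp: tree_order_def)
    then have "(p, q) \<in> E\<^sup>*" using * by (auto simp: tree_order_def)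
    then show "(i, p) \<in> E" using q tree_antisym by blast
  next
    assume ip: "(i, p) \<in> E"
    then have "(i, p) \<in> ?R" "i \<noteq> p" using treeD(2) tree_acyclic by (auto simp: tree_order_def)
    then show "(i, p) \<in> ?R \<and> i \<noteq> p \<and> (\<forall>q. (i, q) \<in> ?R \<longrightarrow> q \<noteq> i \<longrightarrow> (p, q) \<in> ?R)"
      using tree_first_step[OF ip] by (auto simp: tree_order_def)
  qed
  then have 2: "{(i, p). (i, p) \<in> ?R \<and> i \<noteq> p \<and> (\<forall>q. (i, q) \<in> ?R \<longrightarrow> q \<noteq> i \<longrightarrow> (p, q) \<in> ?R)} = E"
    by simp
  show ?thesis unfolding order_tree_def 1 2 ..
qed

lemma forest_order_tree_order:
  assumes "connected_tree V (r, E)"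
  shows "forest_order V (tree_order V (r, E))"
  unfolding forest_order_def
proof (intro conjI ballI allI impI)
  let ?R = "tree_order V (r, E)"
  show "antisym ?R" using tree_antisym by (auto simp: antisym_def tree_order_def)
  show "trans ?R" by (auto simp: trans_def tree_order_def intro: rtrancl_trans)
  show "(j, k) \<in> ?R \<or> (k, j) \<in> ?R" if "(i, j) \<in> ?R" "(i, k) \<in> ?R" for i j k
    using single_valued_confluent[OF tree_sv, of i j k] that by (auto simp: tree_order_def)
  show "conn (below ?R j)" if "j \<in> V" for j
    using assms that desc_tree by (auto simp: connected_tree_def)
  show "\<not> conn (below ?R i \<union> below ?R j)"
    if "i \<in> V" "j \<in> V" "i \<noteq> j" "below ?R i \<inter> below ?R j = {}" for i j
    using assms that desc_tree[of i] desc_tree[of j] unfolding connected_tree_def by metis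
qed (auto simp: tree_order_def)

end

context
  fixes V :: "'v set" and R :: "('v \<times> 'v) set"
  assumes V: "finite V" "conn V" and R: "forest_order V R"
begin

text \<open>Connectedness of \<open>V\<close> turns a forest into a tree: the down-set of a maximal
  element is its component, hence all of \<open>V\<close>.\<close>

lemma ex1_top: "\<exists>!r. r \<in> V \<and> (\<forall>i\<in>V. (i, r) \<in> R)"
proof -
  obtain i where "i \<in> V" using V(2) by (auto simp: conn_iff)
  then obtain r where r: "maxel V R r" using ex_maxel[OF V(1) R] by blast
  then have rV: "r \<in> V" by (simp add: maxel_def)
  have "V \<subseteq> comp V r" using V(2) rV comp_self by (intro conn_subset_comp) auto
  then have "V \<subseteq> below R r" using below_maxel[OF V(1) R r] by simp
  then show ?thesis using rV forest_orderD(3)[OF R]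
    by (intro ex1I[of _ r]) (auto simp: below_def dest: antisymD)
qed

abbreviation "top_node \<equiv> fst (order_tree V R)"
abbreviation "cover \<equiv> snd (order_tree V R)"

lemma top_node: "top_node \<in> V" "\<And>i. i \<in> V \<Longrightarrow> (i, top_node) \<in> R"
  using theI'[OF ex1_top] by (auto simp: order_tree_def)

lemma cover_iff:
  "(i, p) \<in> cover \<longleftrightarrow> (i, p) \<in> R \<and> i \<noteq> p \<and> (\<forall>q. (i, q) \<in> R \<longrightarrow> q \<noteq> i \<longrightarrow> (p, q) \<in> R)"
  by (simp add: order_tree_def)

lemma ex_cover:
  assumes ij: "(i, j) \<in> R" "i \<noteq> j" shows "\<exists>p. (i, p) \<in> cover"
proof -
  note D = forest_orderD[OF R]
  let ?U = "{q. (i, q) \<in> R \<and> q \<noteq> i}"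
  let ?f = "\<lambda>q. card (below R q)"
  have "finite ?U" using V(1) by (rule rev_finite_subset) (use D(1) in auto)
  \<comment> \<open>A smallest down-set is wanted, hence the negated cardinality in
    \<open>ex_maximizer\<close>. Comparability of the elements above i makes p the least of
    them.\<close>
  then obtain p where p: "p \<in> ?U" "\<And>q. q \<in> ?U \<Longrightarrow> - int (?f q) \<le> - int (?f p)"
    using ex_maximizer[of ?U "\<lambda>q. - int (?f q)"] ij by blast
  have "(p, q) \<in> R" if q: "q \<in> ?U" for q
  proof (rule ccontr)
    assume n: "(p, q) \<notin> R"
    then have "(q, p) \<in> R" using D(5)[of i p q] p(1) q by auto
    have "p \<in> V" using p(1) D(1) by auto
    have "below R q \<subseteq> below R p" using \<open>(q, p) \<in> R\<close> D(4) by (auto simp: below_def dest: transD)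
    moreover have "p \<in> below R p" "p \<notin> below R q" using n D(2)[OF \<open>p \<in> V\<close>] by (auto simp: below_def)
    ultimately have "below R q \<subset> below R p" by blast
    then have "?f q < ?f p" using finite_subset[OF below_subset[OF R] V(1)] by (intro psubset_card_mono)
    then show False using p(2)[OF q] by simp
  qed
  then show ?thesis using p(1) by (auto simp: cover_iff)
qed

lemma rtrancl_cover:
  assumes "(i, j) \<in> R" shows "(i, j) \<in> cover\<^sup>*"
  using assms
proof (induction "card {q. (i, q) \<in> R}" arbitrary: i rule: less_induct)
  case less
  note D = forest_orderD[OF R]
  show ?case
  proof (cases "i = j")
    case False
    then obtain p where p: "(i, p) \<in> cover" using ex_cover less.prems by blast
    then have pj: "(p, j) \<in> R" and ip: "(i, p) \<in> R" "i \<noteq> p"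
      using less.prems False by (auto simp: cover_iff)
    have "i \<in> V" using ip D(1) by auto
    have "{q. (p, q) \<in> R} \<subseteq> {q. (i, q) \<in> R}" using ip D(4) by (auto dest: transD)
    moreover have "(i, i) \<in> R" "(p, i) \<notin> R" using D(2)[OF \<open>i \<in> V\<close>] D(3) ip by (auto dest: antisymD)
    ultimately have "{q. (p, q) \<in> R} \<subset> {q. (i, q) \<in> R}" by blast
    moreover have "finite {q. (i, q) \<in> R}" using V(1) by (rule rev_finite_subset) (use D(1) in auto)
    ultimately have "card {q. (p, q) \<in> R} < card {q. (i, q) \<in> R}" by (intro psubset_card_mono)
    from less.hyps[OF this pj] p show ?thesis by (meson converse_rtrancl_into_rtrancl)
  qed simp
qed

lemma tree_order_order_tree: "tree_order V (order_tree V R) = R"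
proof
  note D = forest_orderD[OF R]
  have "(i, j) \<in> R" if "(i, j) \<in> cover\<^sup>*" "i \<in> V" for i j
    using that
  proof (induction rule: rtrancl_induct)
    case (step y z)
    then show ?case using D(4) by (auto simp: cover_iff dest: transD)
  qed (use D(2) in auto)
  then show "tree_order V (order_tree V R) \<subseteq> R" by (auto simp: tree_order_def)
  show "R \<subseteq> tree_order V (order_tree V R)"
    using rtrancl_cover D(1) by (auto simp: tree_order_def)
qed

lemma rooted_order_tree: "rooted_tree_on V (order_tree V R)"
proof -
  note D = forest_orderD[OF R]
  have "cover \<subseteq> V \<times> V" using D(1) by (auto simp: cover_iff)
  moreover have "(top_node, p) \<notin> cover" for p
  proof
    assume p: "(top_node, p) \<in> cover"
    then have "p \<in> V" using D(1) by (auto simp: cover_iff)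
    then show False using p top_node(2)[of p] D(3) by (auto simp: cover_iff dest: antisymD)
  qed
  moreover have "\<exists>!p. (i, p) \<in> cover" if iV: "i \<in> V - {top_node}" for i
  proof -
    obtain p where p: "(i, p) \<in> cover" using ex_cover[of i top_node] top_node(2)[of i] iV by auto
    moreover have "q = p" if "(i, q) \<in> cover" for q
      using that p D(3) by (auto simp: cover_iff dest: antisymD)
    ultimately show ?thesis by blast
  qed
  moreover have "(i, top_node) \<in> cover\<^sup>*" if "i \<in> V" for i
    using rtrancl_cover[OF top_node(2)[OF that]] .
  ultimately show ?thesis using top_node(1)
    unfolding rooted_tree_on_def case_prod_beta by blast
qed

lemma connected_order_tree: "connected_tree V (order_tree V R)"
proof -
  note D = forest_orderD[OF R]
  have b: "desc j (order_tree V R) = below R j" if "j \<in> V" for j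
    using desc_tree[of V top_node cover j] rooted_order_tree that tree_order_order_tree by simp
  show ?thesis unfolding connected_tree_def
    using rooted_order_tree D(6,7) b by metis
qed

end

lemma sum_connected_trees:
  assumes V: "finite V" "conn V"
  shows "(\<Sum>T\<in>{T. connected_tree V T}. \<Prod>j\<in>V. F (desc j T) j) = forest_sum F V"
  unfolding forest_sum_def
proof (rule sum.reindex_bij_witness[where i = "order_tree V" and j = "tree_order V"])
  fix T assume "T \<in> {T. connected_tree V T}"
  moreover obtain r E where T: "T = (r, E)" by fastforce
  ultimately have c: "connected_tree V (r, E)" and t: "rooted_tree_on V (r, E)"
    by (auto simp: connected_tree_def)
  show "order_tree V (tree_order V T) = T" unfolding T by (rule order_tree_tree_order[OF t])
  show "tree_order V T \<in> {R. forest_order V R}"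
    unfolding T using forest_order_tree_order[OF t c] by simp
  show "(\<Prod>j\<in>V. F (below (tree_order V T) j) j) = (\<Prod>j\<in>V. F (desc j T) j)"
    unfolding T using desc_tree[OF t] by (intro prod.cong) auto
next
  fix R assume "R \<in> {R. forest_order V R}"
  then have R: "forest_order V R" by simp
  show "tree_order V (order_tree V R) = R" using tree_order_order_tree[OF V R] .
  show "order_tree V R \<in> {T. connected_tree V T}" using connected_order_tree[OF V R] by simp
qed

end

section \<open>Volumes by cone decomposition\<close>

interpretation lborel_prod: product_sigma_finite "\<lambda>_. lborel :: real measure"
  by standard

text \<open>Coordinates are peeled off one at a time by Fubini and the affine substitution on the
  line. The case \<open>c = 1\<close> gives translation invariance, general \<open>c\<close> the
  scaling of the slices of a cone.\<close>

lemma nn_integral_PiM_affine: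
  fixes t :: "'i \<Rightarrow> real" and c :: real
  assumes J: "finite J" and c: "c > 0"
    and f: "f \<in> borel_measurable (PiM J (\<lambda>_. lborel))"
  shows "(\<integral>\<^sup>+x. f x \<partial>PiM J (\<lambda>_. lborel)) =
    ennreal (c ^ card J) * (\<integral>\<^sup>+x. f (\<lambda>k\<in>J. t k + c * x k) \<partial>PiM J (\<lambda>_. lborel))"
  using J f
proof (induction J arbitrary: f)
  case empty
  then show ?case by (simp add: PiM_empty nn_integral_count_space_finite restrict_def)
next
  case (insert i J)
  note [measurable] = insert.prems
  let ?M = "PiM J (\<lambda>_. lborel :: real measure)"
  let ?N = "PiM (insert i J) (\<lambda>_. lborel :: real measure)"
  define g where "g x = (\<integral>\<^sup>+y. f (x(i := t i + c * y)) \<partial>lborel)" for x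
  have fm: "(\<lambda>(x, y). f (x(i := t i + c * y))) \<in> borel_measurable (?M \<Otimes>\<^sub>M lborel)"
    by measurable
  have gm: "g \<in> borel_measurable ?M"
    unfolding g_def using lborel.borel_measurable_nn_integral[OF fm] by simp
  have gi: "(\<integral>\<^sup>+y. f (x(i := y)) \<partial>lborel) = ennreal c * g x" if "x \<in> space ?M" for x
  proof -
    have "(\<lambda>y. f (x(i := y))) \<in> borel_measurable borel"
      using that by measurable
    from nn_integral_real_affine[OF this, of c "t i"] show ?thesis
      using c by (simp add: g_def)
  qed
  have rm: "(\<lambda>x. f (\<lambda>k\<in>insert i J. t k + c * x k)) \<in> borel_measurable ?N"
    by measurable
  have "(\<integral>\<^sup>+x. f x \<partial>?N) = (\<integral>\<^sup>+x. (\<integral>\<^sup>+y. f (x(i := y)) \<partial>lborel) \<partial>?M)"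
    by (rule lborel_prod.product_nn_integral_insert) (use insert in auto)
  also have "\<dots> = (\<integral>\<^sup>+x. ennreal c * g x \<partial>?M)"
    using gi by (rule nn_integral_cong)
  also have "\<dots> = ennreal c * (\<integral>\<^sup>+x. g x \<partial>?M)"
    by (rule nn_integral_cmult[OF gm])
  also have "(\<integral>\<^sup>+x. g x \<partial>?M) = ennreal (c ^ card J) * (\<integral>\<^sup>+x. g (\<lambda>k\<in>J. t k + c * x k) \<partial>?M)"
    by (rule insert.IH[OF gm])
  also have "(\<integral>\<^sup>+x. g (\<lambda>k\<in>J. t k + c * x k) \<partial>?M) =
      (\<integral>\<^sup>+x. (\<integral>\<^sup>+y. f (\<lambda>k\<in>insert i J. t k + c * (x(i := y)) k) \<partial>lborel) \<partial>?M)"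
    unfolding g_def
  proof (intro nn_integral_cong arg_cong[where f = f])
    fix x y
    show "(\<lambda>k\<in>J. t k + c * x k)(i := t i + c * y) = (\<lambda>k\<in>insert i J. t k + c * (x(i := y)) k)"
      using insert.hyps by auto
  qed
  also have "\<dots> = (\<integral>\<^sup>+x. f (\<lambda>k\<in>insert i J. t k + c * x k) \<partial>?N)"
    by (rule lborel_prod.product_nn_integral_insert[symmetric]) (use insert rm in auto)
  also have "ennreal c * (ennreal (c ^ card J) * x) = ennreal (c ^ card (insert i J)) * x" for x
    using insert.hyps c by (simp add: ennreal_mult mult.assoc)
  finally show ?case .
qed

lemma nn_integral_lborel_translate:
  fixes f :: "'a::euclidean_space \<Rightarrow> ennreal"
  assumes [measurable]: "f \<in> borel_measurable borel"
  shows "(\<integral>\<^sup>+y. f (t + y) \<partial>lborel) = (\<integral>\<^sup>+y. f y \<partial>lborel)"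
  by (subst (2) lborel_distr_plus[symmetric, of t]) (simp add: nn_integral_distr)

lemma nn_integral_lborel_reflect:
  fixes f :: "'a::euclidean_space \<Rightarrow> ennreal"
  assumes [measurable]: "f \<in> borel_measurable borel"
  shows "(\<integral>\<^sup>+y. f (t - y) \<partial>lborel) = (\<integral>\<^sup>+y. f y \<partial>lborel)"
  by (subst (2) lborel_affine[of "-1" t]) (simp_all add: nn_integral_density nn_integral_distr)

text \<open>Evaluate the integral of
  \<open>indicator A (L x) * indicator B y\<close> after the substitutions \<open>y \<leadsto> L x + y\<close> and
  \<open>L x \<leadsto> L x - y\<close>.\<close>

lemma translation_invariant_proportional:
  fixes L :: "'b \<Rightarrow> 'a::euclidean_space"
  assumes M: "sigma_finite_measure M" and [measurable]: "L \<in> measurable M borel"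
    and inv: "\<And>f t. f \<in> borel_measurable borel \<Longrightarrow>
      (\<integral>\<^sup>+x. f (L x + t) \<partial>M) = (\<integral>\<^sup>+x. f (L x) \<partial>M)"
    and [measurable]: "A \<in> sets borel" "B \<in> sets borel"
  shows "emeasure M (L -` A \<inter> space M) * emeasure lborel B =
    emeasure M (L -` B \<inter> space M) * emeasure lborel A"
proof -
  interpret M: sigma_finite_measure M by fact
  interpret P: pair_sigma_finite M lborel by standard
  have ind: "(\<integral>\<^sup>+x. indicator C (L x) \<partial>M) = emeasure M (L -` C \<inter> space M)" if [measurable]: "C \<in> sets borel" for C
  proof -
    have "(\<integral>\<^sup>+x. indicator C (L x) \<partial>M) = (\<integral>\<^sup>+x. indicator (L -` C \<inter> space M) x \<partial>M)"
      by (intro nn_integral_cong) (auto simp: indicator_def)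
    then show ?thesis by simp
  qed
  have "emeasure M (L -` A \<inter> space M) * emeasure lborel B =
      (\<integral>\<^sup>+x. indicator A (L x) * emeasure lborel B \<partial>M)"
    by (subst nn_integral_multc) (simp_all add: ind)
  also have "\<dots> = (\<integral>\<^sup>+x. (\<integral>\<^sup>+y. indicator A (L x) * indicator B (L x + y) \<partial>lborel) \<partial>M)"
  proof (rule nn_integral_cong)
    fix x
    have "emeasure lborel B = (\<integral>\<^sup>+y. indicator B (L x + y) \<partial>lborel)"
      by (subst nn_integral_lborel_translate) simp_all
    then show "indicator A (L x) * emeasure lborel B =
        (\<integral>\<^sup>+y. indicator A (L x) * indicator B (L x + y) \<partial>lborel)"
      by (simp add: nn_integral_cmult)
  qed
  also have "\<dots> = (\<integral>\<^sup>+y. (\<integral>\<^sup>+x. indicator A (L x) * indicator B (L x + y) \<partial>M) \<partial>lborel)"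
    by (rule P.Fubini'[symmetric]) simp
  also have "\<dots> = (\<integral>\<^sup>+y. (\<integral>\<^sup>+x. indicator A (L x - y) * indicator B (L x) \<partial>M) \<partial>lborel)"
  proof (rule nn_integral_cong)
    fix y
    show "(\<integral>\<^sup>+x. indicator A (L x) * indicator B (L x + y) \<partial>M) =
        (\<integral>\<^sup>+x. indicator A (L x - y) * indicator B (L x) \<partial>M)"
      using inv[of "\<lambda>v. indicator A (v - y) * indicator B v" y] by simp
  qed
  also have "\<dots> = (\<integral>\<^sup>+x. (\<integral>\<^sup>+y. indicator A (L x - y) * indicator B (L x) \<partial>lborel) \<partial>M)"
    by (rule P.Fubini') simp
  also have "\<dots> = (\<integral>\<^sup>+x. emeasure lborel A * indicator B (L x) \<partial>M)"
  proof (rule nn_integral_cong)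
    fix x
    have "(\<integral>\<^sup>+y. indicator A (L x - y) \<partial>lborel) = emeasure lborel A"
      by (subst nn_integral_lborel_reflect) simp_all
    then show "(\<integral>\<^sup>+y. indicator A (L x - y) * indicator B (L x) \<partial>lborel) = emeasure lborel A * indicator B (L x)"
      by (simp add: nn_integral_multc)
  qed
  also have "\<dots> = emeasure M (L -` B \<inter> space M) * emeasure lborel A"
    by (subst nn_integral_cmult) (simp_all add: ind mult.commute)
  finally show ?thesis .
qed

text \<open>Over each point of the remaining coordinates the graph of g has a single point. This
  discards the common boundaries of cones.\<close>

lemma AE_PiM_neq:
  fixes g :: "('i \<Rightarrow> real) \<Rightarrow> real"
  assumes J: "finite J" "i \<notin> J"
    and [measurable]: "g \<in> borel_measurable (PiM J (\<lambda>_. lborel))"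
  shows "AE p in PiM (insert i J) (\<lambda>_. lborel). p i \<noteq> g (restrict p J)"
proof -
  let ?M = "PiM J (\<lambda>_. lborel :: real measure)"
  let ?N = "PiM (insert i J) (\<lambda>_. lborel :: real measure)"
  have rm [measurable]: "(\<lambda>p. restrict p J) \<in> measurable ?N ?M"
    by (rule measurable_restrict_subset) auto
  have S: "{p \<in> space ?N. p i = g (restrict p J)} \<in> sets ?N" by measurable
  have "emeasure ?N {p \<in> space ?N. p i = g (restrict p J)} =
      (\<integral>\<^sup>+p. indicator {p \<in> space ?N. p i = g (restrict p J)} p \<partial>?N)"
    using S by simp
  also have "\<dots> = (\<integral>\<^sup>+x. (\<integral>\<^sup>+y. indicator {p \<in> space ?N. p i = g (restrict p J)} (x(i := y)) \<partial>lborel) \<partial>?M)"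
    by (rule lborel_prod.product_nn_integral_insert) (use J S in auto)
  also have "\<dots> = (\<integral>\<^sup>+x. 0 \<partial>?M)"
  proof (rule nn_integral_cong)
    fix x assume x: "x \<in> space ?M"
    then have "restrict (x(i := y)) J = x" for y
      using J by (auto simp: space_PiM PiE_def extensional_def restrict_def)
    then have "(\<integral>\<^sup>+y. indicator {p \<in> space ?N. p i = g (restrict p J)} (x(i := y)) \<partial>lborel) \<le>
        (\<integral>\<^sup>+y. indicator {g x} y \<partial>lborel)"
      by (intro nn_integral_mono) (auto simp: indicator_def)
    also have "\<dots> = 0" by simp
    finally show "(\<integral>\<^sup>+y. indicator {p \<in> space ?N. p i = g (restrict p J)} (x(i := y)) \<partial>lborel) = 0" by simp
  qed
  finally have "emeasure ?N {p \<in> space ?N. p i = g (restrict p J)} = 0" by simp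
  then show ?thesis using S
    by (subst AE_iff_measurable[OF S]) auto
qed

text \<open>The slice at height y of a cone with m-dimensional base and apex at height z is the base
  scaled by 1 - y/z; integration gives the factor height/dimension.\<close>

lemma nn_integral_cone_slices:
  fixes z :: real
  assumes z: "z > 0"
  shows "(\<integral>\<^sup>+y. ennreal ((1 - y / z) ^ m) * indicator {0..z} y \<partial>lborel) = ennreal (z / real (Suc m))"
proof -
  have "((\<lambda>y. - (z / real (Suc m)) * (1 - y / z) ^ Suc m) has_real_derivative (1 - y / z) ^ m) (at y)" for y :: real
  proof -
    have d: "((\<lambda>y. 1 - y / z) has_real_derivative - 1 / z) (at y)"
      using assms by (auto intro!: derivative_eq_intros)
    have "z \<noteq> 0" using assms by simp
    then have e: "- (z / real (Suc m)) * (real (Suc m) * (- 1 / z * (1 - y / z) ^ m)) = (1 - y / z) ^ m"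
      by (simp del: of_nat_Suc)
    show ?thesis
      using DERIV_cmult[OF DERIV_power[OF d, of "Suc m"], of "- (z / real (Suc m))"] e by simp
  qed
  then have "(\<integral>\<^sup>+y. ennreal ((1 - y / z) ^ m) * indicator {0..z} y \<partial>lborel) =
    ennreal (- (z / real (Suc m)) * (1 - z / z) ^ Suc m - - (z / real (Suc m)) * (1 - 0 / z) ^ Suc m)"
    using z by (intro nn_integral_FTC_Icc) (auto simp: has_real_derivative_iff_has_vector_derivative[symmetric]
        intro: has_field_derivative_at_within)
  then show ?thesis using z by simp
qed

section \<open>Recursion for the volumes of the polytopes Q\<close>

text \<open>What the cone decomposition needs of the Cartan matrix: \<open>nonneg\<close> says that
  every principal submatrix has a nonnegative inverse. It and \<open>solution\<close> range over all
  subsets of \<open>N\<close>, since the facets of \<open>Q I\<close> belong to smaller index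
  sets.\<close>

locale obtuse_system =
  fixes N :: "'i set" and A :: "'i \<Rightarrow> 'i \<Rightarrow> real" and u :: "'i \<Rightarrow> real" and z :: "'i set \<Rightarrow> 'i \<Rightarrow> real"
  assumes finite_N: "finite N"
    and obtuse: "\<And>k j. k \<in> N \<Longrightarrow> j \<in> N \<Longrightarrow> k \<noteq> j \<Longrightarrow> A k j \<le> 0"
    and nonneg: "\<And>J c k. J \<subseteq> N \<Longrightarrow> (\<And>j. j \<in> J \<Longrightarrow> 0 \<le> (\<Sum>k\<in>J. c k * A k j)) \<Longrightarrow> k \<in> J \<Longrightarrow> 0 \<le> c k"
    and u_nonneg: "\<And>j. j \<in> N \<Longrightarrow> 0 \<le> u j"
    and solution: "\<And>J j. J \<subseteq> N \<Longrightarrow> j \<in> J \<Longrightarrow> (\<Sum>k\<in>J. z J k * A k j) = u j"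
begin

abbreviation M where "M I \<equiv> PiM I (\<lambda>_. lborel :: real measure)"

text \<open>For \<open>A\<close> the Cartan matrix and \<open>x\<close> the dominant weight with labels \<open>u\<close>, \<open>Q I\<close> is the part of
  the weight polytope of \<open>x\<close> in the dominant chamber, in the coordinates \<open>p\<close> of
  \<open>x - (\<Sum>k\<in>I. p k *\<^sub>R \<alpha> k)\<close>. The origin has the coordinates \<open>z I\<close>.\<close>

definition Q :: "'i set \<Rightarrow> ('i \<Rightarrow> real) set" where
  "Q I = {p \<in> space (M I). (\<forall>k\<in>I. 0 \<le> p k) \<and> (\<forall>j\<in>I. (\<Sum>k\<in>I. p k * A k j) \<le> u j)}"

lemma Q_measurable [measurable]: "I \<subseteq> N \<Longrightarrow> Q I \<in> sets (M I)"
  using finite_subset[OF _ finite_N, of I] unfolding Q_def by measurable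

lemma z_nonneg: "I \<subseteq> N \<Longrightarrow> k \<in> I \<Longrightarrow> 0 \<le> z I k"
  by (rule nonneg[of I]) (auto simp: solution u_nonneg)

text \<open>The difference of \<open>z I\<close> and p is sent by \<open>A\<close> to the slacks of
  the constraints, which are nonnegative, so \<open>nonneg\<close> applies: the apex dominates every
  point of \<open>Q I\<close>.\<close>

lemma Q_le:
  assumes "I \<subseteq> N" "p \<in> Q I" "k \<in> I" shows "p k \<le> z I k"
proof -
  have "0 \<le> z I k - p k"
    using assms by (intro nonneg[of I "\<lambda>k. z I k - p k"])
      (auto simp: left_diff_distrib sum_subtractf solution Q_def)
  then show ?thesis by simp
qed

text \<open>Restricted to \<open>J\<close>, the solution for \<open>I\<close> overshoots
  \<open>u\<close>, because the dropped terms carry nonpositive off-diagonal entries.\<close>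

lemma z_mono:
  assumes "I \<subseteq> N" "J \<subseteq> I" "k \<in> J" shows "z J k \<le> z I k"
proof -
  have fin: "finite I" using assms(1) finite_N finite_subset by blast
  have "0 \<le> z I k - z J k"
  proof (rule nonneg[of J "\<lambda>k. z I k - z J k"])
    fix j assume j: "j \<in> J"
    have "(\<Sum>k\<in>J. z I k * A k j) = u j - (\<Sum>k\<in>I-J. z I k * A k j)"
      using solution[of I j] assms j sum.subset_diff[OF assms(2) fin, of "\<lambda>k. z I k * A k j"] by auto
    moreover have "(\<Sum>k\<in>I-J. z I k * A k j) \<le> 0"
    proof (rule sum_nonpos)
      fix k assume k: "k \<in> I - J"
      then have "A k j \<le> 0" using obtuse[of k j] assms j by blast
      moreover have "0 \<le> z I k" using z_nonneg k assms by blast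
      ultimately show "z I k * A k j \<le> 0" by (simp add: mult_nonneg_nonpos)
    qed
    ultimately show "0 \<le> (\<Sum>k\<in>J. (z I k - z J k) * A k j)"
      using solution[of J j] assms j by (auto simp: left_diff_distrib sum_subtractf)
  qed (use assms in auto)
  then show ?thesis by simp
qed

text \<open>By \<open>Q_le\<close> the coordinate \<open>p i\<close> is squeezed to 0, so
  \<open>Q I\<close> lies in a hyperplane.\<close>

lemma volume_degenerate:
  assumes I: "I \<subseteq> N" and i: "i \<in> I" "z I i = 0"
  shows "emeasure (M I) (Q I) = 0"
proof -
  have fin: "finite I" using I finite_N finite_subset by blast
  have sub: "Q I \<subseteq> (\<Pi>\<^sub>E k\<in>I. if k = i then {0} else UNIV)"
  proof
    fix p assume p: "p \<in> Q I"
    then have "p i = 0" using Q_le[OF I p i(1)] i by (auto simp: Q_def)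
    then show "p \<in> (\<Pi>\<^sub>E k\<in>I. if k = i then {0} else UNIV)"
      using p by (auto simp: Q_def space_PiM PiE_def Pi_def)
  qed
  have "emeasure (M I) (Q I) \<le> emeasure (M I) (\<Pi>\<^sub>E k\<in>I. if k = i then {0} else UNIV)"
    using fin by (intro emeasure_mono[OF sub] sets_PiM_I_finite) auto
  also have "\<dots> = (\<Prod>k\<in>I. emeasure lborel (if k = i then {0} else UNIV :: real set))"
    using fin by (intro lborel_prod.emeasure_PiM) auto
  also have "\<dots> = 0" using fin i by (intro prod_zero) auto
  finally show ?thesis by simp
qed

text \<open>The cone over the facet \<open>p i = 0\<close> of \<open>Q I\<close> with apex \<open>z I\<close>.\<close>

definition cone :: "'i set \<Rightarrow> 'i \<Rightarrow> ('i \<Rightarrow> real) set" where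
  "cone I i = {p \<in> Q I. \<forall>k\<in>I. (z I k - p k) * z I i \<le> (z I i - p i) * z I k}"

lemma cone_measurable [measurable]: "I \<subseteq> N \<Longrightarrow> i \<in> I \<Longrightarrow> cone I i \<in> sets (M I)"
proof -
  assume I: "I \<subseteq> N" "i \<in> I"
  have fin: "finite I" using I finite_N finite_subset by blast
  have c: "(\<lambda>p. p k) \<in> borel_measurable (M I)" if "k \<in> I" for k
    using measurable_component_singleton[OF that, of "\<lambda>_. lborel :: real measure"] by simp
  have "cone I i = Q I \<inter> {p \<in> space (M I). \<forall>k\<in>I. (z I k - p k) * z I i \<le> (z I i - p i) * z I k}"
    by (auto simp: cone_def Q_def)
  also have "\<dots> \<in> sets (M I)"
    using I fin by (intro sets.Int Q_measurable sets.sets_Collect_finite_All borel_measurable_le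
        borel_measurable_times borel_measurable_diff borel_measurable_const c)
  finally show ?thesis .
qed

text \<open>The point combines the apex and the facet point q with weights 1 - s and s. The
  constraints by \<open>u\<close> are equalities at the apex and so pass to q unchanged, while the
  cone inequality for k becomes \<open>0 \<le> q k\<close>.\<close>

lemma cone_slice:
  assumes I: "I \<subseteq> N" and i: "i \<in> I" and zpos: "\<And>k. k \<in> I \<Longrightarrow> 0 < z I k"
    and s: "0 < s" "s \<le> 1" and q: "q \<in> space (M (I - {i}))"
  shows "(\<lambda>k\<in>I - {i}. (1 - s) * z I k + s * q k)(i := (1 - s) * z I i) \<in> cone I i \<longleftrightarrow> q \<in> Q (I - {i})"
    (is "?p \<in> _ \<longleftrightarrow> _")
proof -
  let ?J = "I - {i}"
  have fin: "finite I" using I finite_N finite_subset by blast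
  have pk: "?p k = (1 - s) * z I k + s * q k" if "k \<in> ?J" for k using that by auto
  have pi: "?p i = (1 - s) * z I i" by simp
  have psp: "?p \<in> space (M I)" using i by (auto simp: space_PiM PiE_def extensional_def)
  have sum: "(\<Sum>k\<in>I. ?p k * A k j) = (1 - s) * u j + s * (\<Sum>k\<in>?J. q k * A k j)" if "j \<in> I" for j
  proof -
    have "(\<Sum>k\<in>I. ?p k * A k j) = ?p i * A i j + (\<Sum>k\<in>?J. ?p k * A k j)"
      using fin i by (simp add: sum.remove)
    also have "(\<Sum>k\<in>?J. ?p k * A k j) = (\<Sum>k\<in>?J. (1 - s) * (z I k * A k j) + s * (q k * A k j))"
      by (intro sum.cong refl) (simp add: algebra_simps)
    also have "\<dots> = (1 - s) * (\<Sum>k\<in>?J. z I k * A k j) + s * (\<Sum>k\<in>?J. q k * A k j)"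
      by (simp add: sum.distrib sum_distrib_left)
    also have "?p i * A i j + \<dots> = (1 - s) * (z I i * A i j + (\<Sum>k\<in>?J. z I k * A k j)) + s * (\<Sum>k\<in>?J. q k * A k j)"
      by (simp add: algebra_simps)
    also have "z I i * A i j + (\<Sum>k\<in>?J. z I k * A k j) = u j"
      using solution[OF I that] fin i by (simp add: sum.remove)
    finally show ?thesis .
  qed
  have cond: "(z I k - ?p k) * z I i \<le> (z I i - ?p i) * z I k \<longleftrightarrow> 0 \<le> q k" if k: "k \<in> ?J" for k
  proof -
    have e: "(z I i - ?p i) * z I k - (z I k - ?p k) * z I i = (s * z I i) * q k"
      unfolding pk[OF k] pi by (simp add: algebra_simps)
    have sz: "0 < s * z I i" using s zpos[OF i] by simp
    have "(z I k - ?p k) * z I i \<le> (z I i - ?p i) * z I k \<longleftrightarrow> 0 \<le> (s * z I i) * q k"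
      unfolding e[symmetric] by simp
    also have "\<dots> \<longleftrightarrow> 0 \<le> q k" using sz by (rule mult_le_cancel_left_pos[of _ 0, simplified])
    finally show ?thesis .
  qed
  have sle: "(1 - s) * u j + s * x \<le> u j \<longleftrightarrow> x \<le> u j" for j x
  proof -
    have "(1 - s) * u j + s * x \<le> u j \<longleftrightarrow> s * x \<le> s * u j" by (simp add: algebra_simps)
    also have "\<dots> \<longleftrightarrow> x \<le> u j" using s by simp
    finally show ?thesis .
  qed
  show ?thesis
  proof
    assume p: "?p \<in> cone I i"
    have "0 \<le> q k" if "k \<in> ?J" for k
      using p cond[OF that] that by (auto simp: cone_def)
    moreover have "(\<Sum>k\<in>?J. q k * A k j) \<le> u j" if "j \<in> ?J" for j
      using p sum[of j] that sle by (auto simp: cone_def Q_def)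
    ultimately show "q \<in> Q ?J" using q by (auto simp: Q_def)
  next
    assume qQ: "q \<in> Q ?J"
    then have q0: "0 \<le> q k" if "k \<in> ?J" for k using that by (auto simp: Q_def)
    have "(\<Sum>k\<in>?J. q k * A k j) \<le> u j" if j: "j \<in> I" for j
    proof (cases "j = i")
      case True
      \<comment> \<open>The i-th constraint is not imposed in \<open>Q (I - {i})\<close>; on the
        facet it follows from the signs of the off-diagonal entries and
        \<open>0 \<le> u i\<close>.\<close>
      have "(\<Sum>k\<in>?J. q k * A k i) \<le> 0"
      proof (rule sum_nonpos)
        fix k assume k: "k \<in> ?J"
        then have "A k i \<le> 0" using obtuse[of k i] I i by blast
        then show "q k * A k i \<le> 0" using q0[OF k] by (simp add: mult_nonneg_nonpos)
      qed
      also have "0 \<le> u i" using u_nonneg I i by blast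
      finally show ?thesis using True by simp
    next
      case False
      then show ?thesis using qQ j by (auto simp: Q_def)
    qed
    then have "(\<Sum>k\<in>I. ?p k * A k j) \<le> u j" if "j \<in> I" for j
      unfolding sum[OF that] sle using that by blast
    moreover have "0 \<le> ?p k" if "k \<in> I" for k
    proof (cases "k = i")
      case True
      then show ?thesis using s zpos[OF i] by simp
    next
      case False
      then show ?thesis using that s zpos[OF that] q0[of k] by simp
    qed
    moreover have "(z I k - ?p k) * z I i \<le> (z I i - ?p i) * z I k" if "k \<in> I" for k
      using cond[of k] q0[of k] that by (cases "k = i") auto
    ultimately show "?p \<in> cone I i" using psp unfolding cone_def Q_def by blast
  qed
qed

lemma volume_cone:
  assumes I: "I \<subseteq> N" and i: "i \<in> I" and zpos: "\<And>k. k \<in> I \<Longrightarrow> 0 < z I k"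
  shows "of_nat (card I) * emeasure (M I) (cone I i) = ennreal (z I i) * emeasure (M (I - {i})) (Q (I - {i}))"
proof -
  let ?J = "I - {i}" and ?z = "z I i"
  have fin: "finite I" using I finite_N finite_subset by blast
  have ins: "insert i ?J = I" using i by auto
  have K [measurable]: "cone I i \<in> sets (M I)" using I i by simp
  have QJ [measurable]: "Q ?J \<in> sets (M ?J)" using I by (intro Q_measurable) auto
  \<comment> \<open>The apex height is left out: there the scaling factor is 0, which the affine
    substitution does not allow, and a single height is a null set.\<close>
  have slice: "(\<integral>\<^sup>+x. indicator (cone I i) (x(i := y)) \<partial>M ?J) =
      ennreal ((1 - y / ?z) ^ card ?J) * indicator {0..?z} y * emeasure (M ?J) (Q ?J)" if y: "y \<noteq> ?z" for y
  proof (cases "0 \<le> y \<and> y < ?z")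
    case True
    define s where "s = 1 - y / ?z"
    have s: "0 < s" "s \<le> 1" "y = (1 - s) * ?z" using True zpos[OF i] by (auto simp: s_def field_simps)
    have "(\<lambda>x. indicator (cone I i) (x(i := y)) :: ennreal) \<in> borel_measurable (M ?J)"
    proof -
      have "(\<lambda>x. x(i := y)) \<in> measurable (M ?J) (M (insert i ?J))" by measurable
      then show ?thesis unfolding ins by measurable
    qed
    from nn_integral_PiM_affine[OF _ s(1) this, of "\<lambda>k. (1 - s) * z I k"]
    have "(\<integral>\<^sup>+x. indicator (cone I i) (x(i := y)) \<partial>M ?J) = ennreal (s ^ card ?J) *
        (\<integral>\<^sup>+x. indicator (cone I i) ((\<lambda>k\<in>?J. (1 - s) * z I k + s * x k)(i := y)) \<partial>M ?J)"
      using fin by simp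
    also have "(\<integral>\<^sup>+x. indicator (cone I i) ((\<lambda>k\<in>?J. (1 - s) * z I k + s * x k)(i := y)) \<partial>M ?J) =
        (\<integral>\<^sup>+x. indicator (Q ?J) x \<partial>M ?J)"
    proof (rule nn_integral_cong)
      fix x assume "x \<in> space (M ?J)"
      from cone_slice[OF I i zpos s(1,2) this]
      show "indicator (cone I i) ((\<lambda>k\<in>?J. (1 - s) * z I k + s * x k)(i := y)) = (indicator (Q ?J) x :: ennreal)"
        unfolding s(3) by (auto simp: indicator_def)
    qed
    finally have eq: "(\<integral>\<^sup>+x. indicator (cone I i) (x(i := y)) \<partial>M ?J) =
        ennreal (s ^ card ?J) * (\<integral>\<^sup>+x. indicator (Q ?J) x \<partial>M ?J)" .
    show ?thesis unfolding eq using True by (simp add: s_def)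
  next
    case False
    then have "x(i := y) \<notin> cone I i" for x
      using Q_le[OF I _ i, of "x(i := y)"] i y by (force simp: cone_def Q_def)
    then show ?thesis using False y by (auto simp: indicator_def)
  qed
  have "emeasure (M I) (cone I i) = (\<integral>\<^sup>+p. indicator (cone I i) p \<partial>M (insert i ?J))"
    unfolding ins by simp
  also have "\<dots> = (\<integral>\<^sup>+y. (\<integral>\<^sup>+x. indicator (cone I i) (x(i := y)) \<partial>M ?J) \<partial>lborel)"
    using K fin by (intro lborel_prod.product_nn_integral_insert_rev) (auto simp: insert_absorb[OF i])
  also have "\<dots> = (\<integral>\<^sup>+y. ennreal ((1 - y / ?z) ^ card ?J) * indicator {0..?z} y * emeasure (M ?J) (Q ?J) \<partial>lborel)"
    using slice AE_lborel_singleton[of ?z] by (intro nn_integral_cong_AE) auto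
  also have "\<dots> = ennreal (?z / real (Suc (card ?J))) * emeasure (M ?J) (Q ?J)"
    by (subst nn_integral_multc) (simp_all add: nn_integral_cone_slices[OF zpos[OF i]])
  also have "Suc (card ?J) = card I" by (rule card_Suc_Diff1[OF fin i])
  finally have "of_nat (card I) * emeasure (M I) (cone I i) =
      ennreal (real (card I)) * ennreal (?z / real (card I)) * emeasure (M ?J) (Q ?J)"
    by (simp add: mult.assoc ennreal_of_nat_eq_real_of_nat)
  also have "ennreal (real (card I)) * ennreal (?z / real (card I)) = ennreal ?z"
    using fin i zpos[OF i] by (subst ennreal_mult[symmetric]) (auto simp: card_gt_0_iff)
  finally show ?thesis .
qed

text \<open>The ray from the apex through p first meets a facet \<open>p i = 0\<close> where the
  relative drop \<open>(z I i - p i) / z I i\<close> is largest, so p lies in that cone. Points with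
  ties form a null set.\<close>

lemma volume_eq_sum_cones:
  assumes I: "I \<subseteq> N" "I \<noteq> {}" and zpos: "\<And>k. k \<in> I \<Longrightarrow> 0 < z I k"
  shows "emeasure (M I) (Q I) = (\<Sum>i\<in>I. emeasure (M I) (cone I i))"
proof -
  have fin: "finite I" using I finite_N finite_subset by blast
  have "AE p in M I. k \<noteq> i \<longrightarrow> (z I k - p k) * z I i \<noteq> (z I i - p i) * z I k" if ik: "i \<in> I" "k \<in> I" for i k
  proof (cases "k = i")
    case False
    let ?J = "I - {i}"
    \<comment> \<open>Solving the tie for \<open>p i\<close> exhibits it as a graph over the other
      coordinates.\<close>
    have "AE p in M (insert i ?J). p i \<noteq> (\<lambda>q. z I i - (z I k - q k) * z I i / z I k) (restrict p ?J)"
      using fin ik False by (intro AE_PiM_neq) auto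
    moreover have "insert i ?J = I" using ik by auto
    ultimately have "AE p in M I. p i \<noteq> (\<lambda>q. z I i - (z I k - q k) * z I i / z I k) (restrict p ?J)"
      by metis
    then have "AE p in M I. p i \<noteq> z I i - (z I k - p k) * z I i / z I k"
      using ik False by simp
    then show ?thesis
    proof (eventually_elim, intro impI notI)
      fix p assume ne: "p i \<noteq> z I i - (z I k - p k) * z I i / z I k"
        and eq: "(z I k - p k) * z I i = (z I i - p i) * z I k"
      have "(z I k - p k) * z I i / z I k = z I i - p i"
        unfolding eq using zpos[OF ik(2)] by simp
      then show False using ne by simp
    qed
  qed simp
  then have gen: "AE p in M I. \<forall>i\<in>I. \<forall>k\<in>I. k \<noteq> i \<longrightarrow> (z I k - p k) * z I i \<noteq> (z I i - p i) * z I k"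
    using fin by (simp add: AE_finite_all)
  have "emeasure (M I) (Q I) = (\<integral>\<^sup>+p. indicator (Q I) p \<partial>M I)" using I by simp
  also have "\<dots> = (\<integral>\<^sup>+p. (\<Sum>i\<in>I. indicator (cone I i) p) \<partial>M I)"
    using gen
  proof (intro nn_integral_cong_AE, eventually_elim)
    fix p assume p: "\<forall>i\<in>I. \<forall>k\<in>I. k \<noteq> i \<longrightarrow> (z I k - p k) * z I i \<noteq> (z I i - p i) * z I k"
    show "indicator (Q I) p = (\<Sum>i\<in>I. indicator (cone I i) p :: ennreal)"
    proof (cases "p \<in> Q I")
      case False
      then show ?thesis by (simp add: cone_def)
    next
      case True
      define h where "h i = (z I i - p i) / z I i" for i
      define m where "m = (SOME m. m \<in> I \<and> (\<forall>k\<in>I. h k \<le> h m))"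
      have "Max (h ` I) \<in> h ` I" using fin I by (intro Max_in) auto
      moreover have "h k \<le> Max (h ` I)" if "k \<in> I" for k using fin that by (intro Max_ge) auto
      ultimately have "\<exists>m. m \<in> I \<and> (\<forall>k\<in>I. h k \<le> h m)" by auto
      from someI_ex[OF this] have m: "m \<in> I" "\<And>k. k \<in> I \<Longrightarrow> h k \<le> h m" unfolding m_def by auto
      have "(z I k - p k) * z I m \<le> (z I m - p m) * z I k" if k: "k \<in> I" for k
      proof -
        have "z I k - p k \<le> h m * z I k"
          using m(2)[OF k] zpos[OF k] unfolding h_def[of k] by (simp only: pos_divide_le_eq)
        then have "(z I k - p k) * z I m \<le> h m * z I k * z I m"
          using zpos[OF m(1)] by (intro mult_right_mono) auto
        also have "\<dots> = (z I m - p m) * z I k"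
          using zpos[OF m(1)] by (simp add: h_def)
        finally show ?thesis .
      qed
      then have pm: "p \<in> cone I m" using True by (simp add: cone_def)
      have "p \<notin> cone I i" if "i \<in> I" "i \<noteq> m" for i
      proof
        assume "p \<in> cone I i"
        then have "(z I m - p m) * z I i = (z I i - p i) * z I m"
          using pm m(1) that(1) unfolding cone_def by (intro antisym) auto
        then show False using p[rule_format, OF that(1) m(1)] that(2) by blast
      qed
      then have "(\<Sum>i\<in>I. indicator (cone I i) p :: ennreal) = (\<Sum>i\<in>I. if i = m then 1 else 0)"
        using pm by (intro sum.cong) auto
      also have "\<dots> = 1" using fin m by simp
      finally show ?thesis using True by simp
    qed
  qed
  also have "\<dots> = (\<Sum>i\<in>I. emeasure (M I) (cone I i))"
    using I by (subst nn_integral_sum) auto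
  finally show ?thesis .
qed

text \<open>If some \<open>z I k\<close> is 0, both sides vanish: the term i = k has factor 0, and
  for i \<noteq> k monotonicity gives \<open>z (I - {i}) k = 0\<close>, so that facet is degenerate
  too.\<close>

lemma volume_rec:
  assumes I: "I \<subseteq> N"
  shows "of_nat (card I) * emeasure (M I) (Q I) =
    (\<Sum>i\<in>I. ennreal (z I i) * emeasure (M (I - {i})) (Q (I - {i})))"
proof (cases "I \<noteq> {} \<and> (\<forall>k\<in>I. 0 < z I k)")
  case True
  then show ?thesis
    using volume_eq_sum_cones[OF I] volume_cone[OF I] by (simp add: sum_distrib_left)
next
  case False
  show ?thesis
  proof (cases "I = {}")
    case False
    with \<open>\<not> (I \<noteq> {} \<and> (\<forall>k\<in>I. 0 < z I k))\<close> obtain k where k: "k \<in> I" "z I k = 0"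
      using z_nonneg[OF I] by (metis antisym_conv3 linorder_not_less)
    have "ennreal (z I i) * emeasure (M (I - {i})) (Q (I - {i})) = 0" if i: "i \<in> I" for i
    proof (cases "i = k")
      case False
      have "z (I - {i}) k \<le> 0" using z_mono[OF I, of "I - {i}" k] k False by auto
      moreover have "0 \<le> z (I - {i}) k" using z_nonneg[of "I - {i}" k] I k False by auto
      ultimately have "z (I - {i}) k = 0" by simp
      then show ?thesis using volume_degenerate[of "I - {i}" k] I k False by auto
    qed (simp add: k)
    then have "(\<Sum>i\<in>I. ennreal (z I i) * emeasure (M (I - {i})) (Q (I - {i}))) = 0"
      by (rule sum.neutral[rule_format])
    then show ?thesis using volume_degenerate[OF I k] by simp
  qed simp
qed

lemma volume_empty: "emeasure (M {}) (Q {}) = 1"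
  by (simp add: Q_def space_PiM PiM_empty)

end

section \<open>The weight polytope\<close>

context simple_system
begin

section \<open>Root coordinates and the normalized volume\<close>

abbreviation "lin \<equiv> \<lambda>p. \<Sum>k=1..n. p k *\<^sub>R \<alpha> k"
abbreviation "cube \<equiv> PiM {1..n} (\<lambda>_. lborel :: real measure)"

lemma lin_measurable [measurable]: "lin \<in> borel_measurable cube"
  by measurable

lemma lin_translate:
  fixes t :: 'a
  assumes f: "f \<in> borel_measurable borel"
  shows "(\<integral>\<^sup>+p. f (lin p + t) \<partial>cube) = (\<integral>\<^sup>+p. f (lin p) \<partial>cube)"
proof -
  have m: "(\<lambda>p. f (lin p)) \<in> borel_measurable cube"
    by (rule measurable_compose[OF lin_measurable f])
  have e: "lin (\<lambda>k\<in>{1..n}. t \<bullet> coweight k + 1 * p k) = lin p + t" for p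
  proof -
    have "lin (\<lambda>k\<in>{1..n}. t \<bullet> coweight k + 1 * p k) = lin (\<lambda>k. t \<bullet> coweight k + 1 * p k)"
      by (intro sum.cong) auto
    also have "\<dots> = (\<Sum>k=1..n. (t \<bullet> coweight k) *\<^sub>R \<alpha> k) + lin p"
      by (simp add: scaleR_add_left sum.distrib)
    finally show ?thesis using expand[of t] by simp
  qed
  show ?thesis
    using nn_integral_PiM_affine[OF finite_atLeastAtMost zero_less_one m, of "\<lambda>k. t \<bullet> coweight k"]
    unfolding e by simp
qed

lemma root_parallelepiped_eq:
  "root_parallelepiped n \<alpha> = {v. \<forall>k\<in>{1..n}. 0 \<le> v \<bullet> coweight k \<and> v \<bullet> coweight k \<le> 1}"
proof safe
  fix v k assume "v \<in> root_parallelepiped n \<alpha>" and k: "k \<in> {1..n}"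
  then obtain c where c: "v = lin c" "\<forall>i\<in>{1..n}. 0 \<le> c i \<and> c i \<le> 1"
    by (auto simp: root_parallelepiped_def)
  show "0 \<le> v \<bullet> coweight k" "v \<bullet> coweight k \<le> 1"
    unfolding c(1) coweight_sum[OF k] using c(2) k by auto
next
  fix v assume "\<forall>k\<in>{1..n}. 0 \<le> v \<bullet> coweight k \<and> v \<bullet> coweight k \<le> 1"
  then show "v \<in> root_parallelepiped n \<alpha>"
    unfolding root_parallelepiped_def mem_Collect_eq
    by (intro exI[of _ "\<lambda>k. v \<bullet> coweight k"] conjI expand)
qed

lemma root_parallelepiped_borel: "root_parallelepiped n \<alpha> \<in> sets borel"
proof -
  have "root_parallelepiped n \<alpha> =
      (\<Inter>k\<in>{1..n}. {v. 0 \<le> v \<bullet> coweight k} \<inter> {v. v \<bullet> coweight k \<le> 1})"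
    by (auto simp: root_parallelepiped_eq)
  moreover have "closed (\<Inter>k\<in>{1..n}. {v. 0 \<le> v \<bullet> coweight k} \<inter> {v. v \<bullet> coweight k \<le> 1})"
    by (intro closed_INT ballI closed_Int closed_Collect_le continuous_intros)
  ultimately show ?thesis by (simp add: borel_closed)
qed

lemma bounded_root_parallelepiped: "bounded (root_parallelepiped n \<alpha>)"
proof (rule boundedI)
  fix v assume "v \<in> root_parallelepiped n \<alpha>"
  then obtain c where c: "v = lin c" "\<forall>i\<in>{1..n}. 0 \<le> c i \<and> c i \<le> 1"
    by (auto simp: root_parallelepiped_def)
  have "norm v \<le> (\<Sum>k=1..n. norm (c k *\<^sub>R \<alpha> k))" unfolding c(1) by (rule norm_sum)
  also have "\<dots> \<le> (\<Sum>k=1..n. norm (\<alpha> k))"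
    using c(2) by (intro sum_mono) (auto intro: mult_left_le_one_le)
  finally show "norm v \<le> (\<Sum>k=1..n. norm (\<alpha> k))" .
qed

text \<open>The parallelepiped pulls back to the unit cube, so translation invariance identifies the
  Jacobian of \<open>lin\<close> with the volume of the parallelepiped.\<close>

lemma emeasure_lborel_lin:
  assumes S: "S \<in> sets borel"
  shows "emeasure lborel S = emeasure cube (lin -` S \<inter> space cube) * emeasure lborel (root_parallelepiped n \<alpha>)"
proof -
  have "lin -` root_parallelepiped n \<alpha> \<inter> space cube = ({1..n} \<rightarrow>\<^sub>E {0..1})"
    by (auto simp: root_parallelepiped_eq coweight_sum space_PiM PiE_def Pi_def)
  moreover have "emeasure cube ({1..n} \<rightarrow>\<^sub>E {0..1}) = 1"
    by (subst lborel_prod.emeasure_PiM) auto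
  ultimately have "emeasure cube (lin -` root_parallelepiped n \<alpha> \<inter> space cube) = 1" by simp
  then show ?thesis
    using translation_invariant_proportional[OF lborel_prod.sigma_finite lin_measurable lin_translate S root_parallelepiped_borel]
    by simp
qed

lemma emeasure_root_parallelepiped:
  "emeasure lborel (root_parallelepiped n \<alpha>) \<noteq> 0" "emeasure lborel (root_parallelepiped n \<alpha>) \<noteq> \<infinity>"
proof -
  show "emeasure lborel (root_parallelepiped n \<alpha>) \<noteq> 0"
  proof
    assume "emeasure lborel (root_parallelepiped n \<alpha>) = 0"
    then have "emeasure lborel (UNIV :: 'a set) = 0" using emeasure_lborel_lin[of UNIV] by simp
    then show False by simp
  qed
  show "emeasure lborel (root_parallelepiped n \<alpha>) \<noteq> \<infinity>"
    using emeasure_bounded_finite[OF bounded_root_parallelepiped] by simp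
qed

lemma root_volume_eq:
  assumes S: "S \<in> sets borel" and e: "emeasure lborel S = ennreal r * emeasure lborel (root_parallelepiped n \<alpha>)" and r: "0 \<le> r"
  shows "root_volume n \<alpha> S = r"
proof -
  have "measure lebesgue S = measure lborel S" "measure lebesgue (root_parallelepiped n \<alpha>) = measure lborel (root_parallelepiped n \<alpha>)"
    using S root_parallelepiped_borel by (simp_all add: measure_completion)
  moreover have "measure lborel S = r * measure lborel (root_parallelepiped n \<alpha>)"
    unfolding measure_def e using r by (simp add: enn2real_mult)
  moreover have "measure lborel (root_parallelepiped n \<alpha>) \<noteq> 0"
    using emeasure_root_parallelepiped by (simp add: measure_def enn2real_eq_0_iff)
  ultimately show ?thesis by (simp add: root_volume_def)
qed

section \<open>Decomposition of the polytope into chambers\<close>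

text \<open>The image of Lebesgue measure under the linear bijection \<open>w\<close> is translation
  invariant, hence proportional to it; the unit ball, preserved by an isometry, shows that the
  factor is 1.\<close>

lemma emeasure_weyl_vimage:
  assumes w: "w \<in> W" and S: "S \<in> sets borel"
  shows "emeasure lborel (w -` S) = emeasure lborel S"
proof -
  obtain w' where w': "w' \<in> W" "\<And>v. w' (w v) = v" "\<And>v. w (w' v) = v" using weyl_inverse[OF w] by blast
  have wm [measurable]: "w \<in> borel_measurable borel"
    using weyl_linear[OF w] by (intro borel_measurable_continuous_onI linear_continuous_on) (simp add: linear_conv_bounded_linear)
  have inv: "(\<integral>\<^sup>+v. f (w v + t) \<partial>lborel) = (\<integral>\<^sup>+v. f (w v) \<partial>lborel)"
    if f [measurable]: "f \<in> borel_measurable borel" for f :: "'a \<Rightarrow> ennreal" and t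
  proof -
    have "w v + t = w (w' t + v)" for v
      using w'(3)[of t] linear_add[OF weyl_linear[OF w]] by (simp add: add.commute)
    then show ?thesis using nn_integral_lborel_translate[of "\<lambda>v. f (w v)" "w' t"] by simp
  qed
  have "w -` ball 0 1 = ball 0 1"
    using weyl_inner[OF w] by (auto simp: norm_eq_sqrt_inner)
  moreover have "emeasure lborel (w -` S \<inter> space lborel) * emeasure lborel (ball 0 1 :: 'a set) =
      emeasure lborel (w -` ball 0 1 \<inter> space lborel) * emeasure lborel S"
    using S by (intro translation_invariant_proportional[OF lborel.sigma_finite_measure_axioms _ inv]) auto
  ultimately have "emeasure lborel (ball 0 1 :: 'a set) * emeasure lborel (w -` S) = emeasure lborel (ball 0 1 :: 'a set) * emeasure lborel S"
    by (simp add: mult.commute)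
  moreover have "emeasure lborel (ball 0 1 :: 'a set) \<noteq> 0" "emeasure lborel (ball 0 1 :: 'a set) \<noteq> top"
    using emeasure_bounded_finite[of "ball 0 1 :: 'a set"] content_ball_pos[of 1 "0 :: 'a"]
    by (auto simp: measure_def)
  ultimately show ?thesis by (simp add: ennreal_mult_cancel_left)
qed

lemma AE_regular: "AE v in lborel. \<forall>w\<in>W. \<forall>i\<in>{1..n}. w v \<bullet> \<alpha> i \<noteq> 0"
proof -
  have "AE v in lborel. w v \<bullet> \<alpha> i \<noteq> 0" if w: "w \<in> W" and i: "i \<in> {1..n}" for w i
  proof -
    obtain w' where w': "w' \<in> W" "\<And>v. w' (w v) = v" "\<And>v. w (w' v) = v" using weyl_inverse[OF w] by blast
    let ?b = "w' (\<alpha> i)"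
    have wb: "w v \<bullet> \<alpha> i = ?b \<bullet> v" for v using weyl_inner[OF w, of v ?b] w' by (simp add: inner_commute)
    have "?b \<noteq> 0" using simple_nz[OF i] w'(3)[of "\<alpha> i"] linear_0[OF weyl_linear[OF w]] by auto
    then have "negligible {v. ?b \<bullet> v = 0}" by (intro negligible_hyperplane) auto
    moreover have "{v. ?b \<bullet> v = 0} \<in> sets borel" by (intro borel_closed closed_hyperplane)
    ultimately have "{v. ?b \<bullet> v = 0} \<in> null_sets lborel"
      by (simp add: negligible_iff_null_sets null_sets_def)
    then show ?thesis by (rule AE_I') (auto simp: wb)
  qed
  then show ?thesis using finite_weyl by (simp add: AE_finite_all)
qed

lemma weyl_image_polytope: "w \<in> W \<Longrightarrow> v \<in> weight_polytope \<Phi> x \<Longrightarrow> w v \<in> weight_polytope \<Phi> x"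
proof -
  assume w: "w \<in> W" and v: "v \<in> weight_polytope \<Phi> x"
  have "w ` {w' x | w'. w' \<in> W} \<subseteq> {w' x | w'. w' \<in> W}"
    using weyl_compose[OF w] by auto (metis comp_apply)
  then have "convex hull (w ` {w' x | w'. w' \<in> W}) \<subseteq> weight_polytope \<Phi> x"
    unfolding weight_polytope_def by (rule hull_mono)
  then show ?thesis using v convex_hull_linear_image[OF weyl_linear[OF w], of "{w' x | w'. w' \<in> W}"]
    by (auto simp: weight_polytope_def)
qed

lemma closed_polytope: "closed (weight_polytope \<Phi> x)"
proof -
  have "{w x | w. w \<in> W} = (\<lambda>w. w x) ` W" by auto
  then have "finite {w x | w. w \<in> W}" using finite_weyl by simp
  then show ?thesis unfolding weight_polytope_def by (intro compact_imp_closed finite_imp_compact_convex_hull)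
qed

lemma closed_dom: "closed {v. dom v}"
proof -
  have "{v. dom v} = (\<Inter>i\<in>{1..n}. {v. 0 \<le> v \<bullet> \<alpha> i})" by (auto simp: dom_def)
  also have "closed \<dots>" by (intro closed_INT ballI closed_Collect_le continuous_intros)
  finally show ?thesis .
qed

text \<open>Outside finitely many hyperplanes exactly one w takes v into the dominant chamber, so
  the indicator of the polytope is almost everywhere the sum over \<open>W\<close> of the indicators
  of the preimages of its dominant part, which all have the same volume.\<close>

lemma emeasure_polytope:
  "emeasure lborel (weight_polytope \<Phi> x) =
    of_nat (card W) * emeasure lborel (weight_polytope \<Phi> x \<inter> {v. dom v})"
proof -
  let ?P = "weight_polytope \<Phi> x" and ?D = "weight_polytope \<Phi> x \<inter> {v. dom v}"
  have D: "?D \<in> sets borel" using closed_polytope closed_dom by (intro borel_closed closed_Int)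
  have P: "?P \<in> sets borel" using closed_polytope by (intro borel_closed)
  have wm [measurable]: "w \<in> borel_measurable borel" if "w \<in> W" for w
    using weyl_linear[OF that] by (intro borel_measurable_continuous_onI linear_continuous_on) (simp add: linear_conv_bounded_linear)
  have wD: "w -` ?D \<in> sets borel" if "w \<in> W" for w
    using measurable_sets[OF wm[OF that] D] by simp
  have "emeasure lborel ?P = (\<integral>\<^sup>+v. indicator ?P v \<partial>lborel)" using P by simp
  also have "\<dots> = (\<integral>\<^sup>+v. (\<Sum>w\<in>W. indicator (w -` ?D) v) \<partial>lborel)"
    using AE_regular
  proof (intro nn_integral_cong_AE, eventually_elim)
    fix v assume reg: "\<forall>w\<in>W. \<forall>i\<in>{1..n}. w v \<bullet> \<alpha> i \<noteq> 0"
    obtain w where w: "w \<in> W" "dom (w v)" using ex_dom by blast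
    obtain w' where w': "w' \<in> W" "\<And>v. w' (w v) = v" "\<And>v. w (w' v) = v" using weyl_inverse[OF w(1)] by blast
    have pos: "w v \<bullet> \<alpha> i > 0" if "i \<in> {1..n}" for i
      using reg w that by (metis dom_def order_le_less)
    have uniq: "y = w" if y: "y \<in> W" "dom (y v)" for y
    proof -
      \<comment> \<open>The map \<open>y \<circ> w'\<close> takes the strictly dominant
        \<open>w v\<close> to the dominant \<open>y v\<close>.\<close>
      have "y \<circ> w' = id"
        using weyl_simply_transitive[OF weyl_compose[OF y(1) w'(1)] pos] y w'(2) by simp
      then show ?thesis using w'(2) by (metis comp_apply ext id_apply)
    qed
    have iff: "v \<in> ?P \<longleftrightarrow> y v \<in> ?P" if "y \<in> W" for y
      using weyl_image_polytope that weyl_inverse[OF that] by metis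
    have "(\<Sum>y\<in>W. indicator (y -` ?D) v :: ennreal) = (\<Sum>y\<in>W. if y = w then indicator ?P v else 0)"
    proof (rule sum.cong[OF refl])
      fix y assume y: "y \<in> W"
      show "(indicator (y -` ?D) v :: ennreal) = (if y = w then indicator ?P v else 0)"
      proof (cases "y = w")
        case True
        then show ?thesis using iff[OF w(1)] w(2) by (simp add: indicator_def)
      next
        case False
        then have "\<not> dom (y v)" using uniq[OF y] by blast
        then show ?thesis using False by simp
      qed
    qed
    also have "\<dots> = indicator ?P v" using finite_weyl w by simp
    finally show "indicator ?P v = (\<Sum>y\<in>W. indicator (y -` ?D) v :: ennreal)" by simp
  qed
  also have "\<dots> = (\<Sum>w\<in>W. emeasure lborel (w -` ?D))"
    using wD by (subst nn_integral_sum) auto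
  also have "\<dots> = (\<Sum>w\<in>W. emeasure lborel ?D)"
    using emeasure_weyl_vimage[OF _ D] by (intro sum.cong) auto
  finally show ?thesis by simp
qed

text \<open>In the second direction a hyperplane separating \<open>v\<close> from the polytope is moved by \<open>W\<close>
  until its normal is dominant; this does not spoil the separation.\<close>

lemma polytope_dom_iff:
  assumes x: "dom x"
  shows "v \<in> weight_polytope \<Phi> x \<and> dom v \<longleftrightarrow> dom v \<and> (\<forall>k\<in>{1..n}. v \<bullet> coweight k \<le> x \<bullet> coweight k)"
proof safe
  fix k assume v: "v \<in> weight_polytope \<Phi> x" and k: "k \<in> {1..n}"
  have "convex {v. v \<bullet> coweight k \<le> x \<bullet> coweight k}"
    using convex_halfspace_le[of "coweight k"] by (simp add: inner_commute)
  then have "weight_polytope \<Phi> x \<subseteq> {v. v \<bullet> coweight k \<le> x \<bullet> coweight k}"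
    unfolding weight_polytope_def using weyl_le_dom[OF _ x k] by (intro hull_minimal) auto
  then show "v \<bullet> coweight k \<le> x \<bullet> coweight k" using v by auto
next
  assume v: "dom v" and le: "\<forall>k\<in>{1..n}. v \<bullet> coweight k \<le> x \<bullet> coweight k"
  show "v \<in> weight_polytope \<Phi> x"
  proof (rule ccontr)
    assume "v \<notin> weight_polytope \<Phi> x"
    then obtain a b where ab: "a \<bullet> v < b" "\<And>y. y \<in> weight_polytope \<Phi> x \<Longrightarrow> a \<bullet> y > b"
      using separating_hyperplane_closed_point[of "weight_polytope \<Phi> x" v] closed_polytope
      by (auto simp: weight_polytope_def)
    define l where "l = - a"
    obtain w where w: "w \<in> W" "dom (w l)" using ex_dom by blast
    obtain w' where w': "w' \<in> W" "\<And>v. w' (w v) = v" "\<And>v. w (w' v) = v" using weyl_inverse[OF w(1)] by blast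
    have "l \<bullet> v = (\<Sum>i=1..n. (l \<bullet> coweight i) * (\<alpha> i \<bullet> v))" by (rule inner_expand)
    also have "\<dots> \<le> (\<Sum>i=1..n. (w l \<bullet> coweight i) * (\<alpha> i \<bullet> v))"
      using weyl_le_dom[OF w'(1) w(2)] w'(2) v
      by (intro sum_mono mult_right_mono) (auto simp: dom_def inner_commute)
    also have "\<dots> = v \<bullet> w l" unfolding inner_commute[of v "w l"] by (rule inner_expand[symmetric])
    also have "\<dots> = (\<Sum>i=1..n. (v \<bullet> coweight i) * (\<alpha> i \<bullet> w l))" by (rule inner_expand)
    also have "\<dots> \<le> (\<Sum>i=1..n. (x \<bullet> coweight i) * (\<alpha> i \<bullet> w l))"
      using le w(2) by (intro sum_mono mult_right_mono) (auto simp: dom_def inner_commute)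
    also have "\<dots> = x \<bullet> w l" by (rule inner_expand[symmetric])
    also have "\<dots> = w' x \<bullet> l" using weyl_inner[OF w'(1), of x "w l"] w'(2) by simp
    also have "\<dots> < - b"
      using ab(2)[of "w' x"] w'(1) hull_inc[of "w' x" "{w x | w. w \<in> W}" convex]
      by (auto simp: l_def weight_polytope_def inner_commute)
    finally show False using ab(1) by (simp add: l_def)
  qed
qed

text \<open>A component C of the diagram and its complement span orthogonal subspaces. Simple
  reflections preserve both, and every root is up to sign a word applied to a simple root, so the
  roots split into orthogonal parts; irreducibility makes the second one empty.\<close>

lemma conn_dynkin:
  assumes irr: "irreducible_root_system \<Phi>"
  shows "induced_connected (dynkin_adj \<alpha>) {1..n}"
proof -
  interpret G: sym_graph "dynkin_adj \<alpha>"
    by standard (simp add: dynkin_adj_def inner_commute)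
  have ne: "{1..n} \<noteq> {}"
    using rank DIM_positive[where 'a = 'a] by auto
  then obtain r where r: "r \<in> {1..n}" by blast
  define C where "C = G.comp {1..n} r"
  have C: "C \<subseteq> {1..n}" "r \<in> C"
    unfolding C_def using G.comp_subset[OF r] G.comp_self by blast+
  have orth: "\<alpha> i \<bullet> \<alpha> j = 0" if "i \<in> C" "j \<in> {1..n} - C" for i j
  proof -
    have "i \<in> {1..n}" "j \<in> {1..n}" "j \<noteq> i" "j \<notin> C" using that C by auto
    then show ?thesis using G.comp_closed[of i "{1..n}" r j] that(1) unfolding C_def
      by (metis dynkin_adj_def inner_commute)
  qed
  define A where "A = \<Phi> \<inter> span (\<alpha> ` C)"
  define B where "B = \<Phi> \<inter> span (\<alpha> ` ({1..n} - C))"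
  have AB: "a \<bullet> b = 0" if "a \<in> span (\<alpha> ` C)" "b \<in> span (\<alpha> ` ({1..n} - C))" for a b
  proof -
    have "orthogonal a (\<alpha> j)" if "j \<in> {1..n} - C" for j
      using orthogonal_to_span[OF \<open>a \<in> span (\<alpha> ` C)\<close>, of "\<alpha> j"] orth that
      by (auto simp: orthogonal_def inner_commute)
    then have "orthogonal a b" by (intro orthogonal_to_span[OF that(2)]) blast
    then show ?thesis by (simp add: orthogonal_def)
  qed
  have word: "word is (\<alpha> i) \<in> span (\<alpha> ` J)"
    if "set is \<subseteq> {1..n}" "i \<in> J" "J = C \<or> J = {1..n} - C" for "is" i J
    using that(1)
  proof (induction "is")
    case Nil
    then show ?case using that(2) by (auto intro: span_base)
  next
    case (Cons j "is")
    let ?v = "word is (\<alpha> i)"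
    have v: "?v \<in> span (\<alpha> ` J)" using Cons by simp
    have "s j ?v \<in> span (\<alpha> ` J)"
    proof (cases "j \<in> J")
      case True
      then show ?thesis unfolding reflection_def by (intro span_diff span_scale v) (auto intro: span_base)
    next
      case False
      have j: "j \<in> {1..n}" using Cons.prems by simp
      have "?v \<bullet> \<alpha> j = 0"
        using that(3)
      proof
        assume J: "J = C"
        then have "\<alpha> j \<in> span (\<alpha> ` ({1..n} - C))" using j False by (intro span_base) blast
        then show ?thesis using AB v J by blast
      next
        assume J: "J = {1..n} - C"
        then have "\<alpha> j \<in> span (\<alpha> ` C)" using j False by (intro span_base) blast
        then show ?thesis using AB[of "\<alpha> j" ?v] v J by (simp add: inner_commute)
      qed
      then show ?thesis unfolding reflection_def using v by (simp add: coroot_def)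
    qed
    then show ?case by simp
  qed
  have "b \<in> A \<union> B" if b: "b \<in> \<Phi>" for b
  proof -
    have *: "c \<in> span (\<alpha> ` C) \<or> c \<in> span (\<alpha> ` ({1..n} - C))" if c: "pos c" for c
      using pos_root_conj_simple[OF c] word by (metis DiffI)
    show ?thesis using root_cases[OF b] *[of b] *[of "- b"] b span_neg[of "- b"]
      by (auto simp: A_def B_def)
  qed
  then have "A \<union> B = \<Phi>" by (auto simp: A_def B_def)
  moreover have "A \<inter> B = {}"
    using AB root_nz by (auto simp: A_def B_def) (metis inner_eq_zero_iff)
  moreover have "\<alpha> r \<in> A" unfolding A_def using simple_root[OF r] C(2) by (intro IntI span_base) auto
  then have "A \<noteq> {}" by blast
  moreover have "\<forall>a\<in>A. \<forall>b\<in>B. a \<bullet> b = 0" using AB by (auto simp: A_def B_def)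
  ultimately have "B = {}" using irr unfolding irreducible_root_system_def by metis
  have "{1..n} - C = {}"
  proof (rule ccontr)
    assume "{1..n} - C \<noteq> {}"
    then obtain j where j: "j \<in> {1..n} - C" by blast
    then have "\<alpha> j \<in> B" unfolding B_def by (intro IntI span_base simple_root) auto
    then show False using \<open>B = {}\<close> by simp
  qed
  then have "C = {1..n}" using C by blast
  then show ?thesis using G.conn_comp[of "{1..n}" r] by (simp add: C_def)
qed

text \<open>The coordinates of \<open>\<Sum>i\<in>I. u i *\<^sub>R \<omega>\<^sub>i\<^sup>I\<close> in the basis of the simple roots \<open>\<alpha> k\<close> for \<open>k \<in> I\<close>.\<close>

definition sol :: "(nat \<Rightarrow> real) \<Rightarrow> nat set \<Rightarrow> nat \<Rightarrow> real" where
  "sol u I k = 2 / (\<alpha> k \<bullet> \<alpha> k) *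
     (\<Sum>i\<in>I. u i * (fundamental_weight \<alpha> I i \<bullet> fundamental_weight \<alpha> I k))"

text \<open>Pairing the weight with the k-th fundamental weight of \<open>I\<close> isolates its
  \<alpha> k-coefficient times (\<alpha> k, \<alpha> k)/2; this is the origin of the constant in
  \<open>sol\<close>.\<close>

lemma sol_solution:
  assumes I: "I \<subseteq> {1..n}" and j: "j \<in> I"
  shows "(\<Sum>k\<in>I. sol u I k * (\<alpha> k \<bullet> coroot (\<alpha> j))) = u j"
proof -
  have fin: "finite I" using I finite_subset by blast
  have inj: "inj_on \<alpha> I" using inj_simple I by (rule inj_on_subset)
  have ind: "independent (\<alpha> ` I)" using indep_simple by (rule independent_mono) (use I in auto)
  note dual = fundamental_weight_dual[OF inj ind]
  define y where "y = (\<Sum>i\<in>I. u i *\<^sub>R fundamental_weight \<alpha> I i)"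
  have "y \<in> span (\<alpha> ` I)" unfolding y_def using dual(1) by (intro span_sum span_scale)
  then obtain c where "y = (\<Sum>a\<in>\<alpha> ` I. c a *\<^sub>R a)"
    by (subst (asm) span_finite) (use fin in auto)
  then have y: "y = (\<Sum>k\<in>I. c (\<alpha> k) *\<^sub>R \<alpha> k)" by (subst (asm) sum.reindex[OF inj]) simp
  have "sol u I k = c (\<alpha> k)" if k: "k \<in> I" for k
  proof -
    have nz: "\<alpha> k \<noteq> 0" using simple_nz k I by blast
    have d: "\<alpha> i \<bullet> fundamental_weight \<alpha> I k = (if i = k then (\<alpha> k \<bullet> \<alpha> k) / 2 else 0)" if i: "i \<in> I" for i
    proof -
      have "\<alpha> i \<noteq> 0" using simple_nz i I by blast
      then show ?thesis using dual(2)[OF k i]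
        by (auto simp: coroot_def inner_commute field_simps split: if_splits)
    qed
    have "y \<bullet> fundamental_weight \<alpha> I k = (\<Sum>i\<in>I. c (\<alpha> i) * (if i = k then (\<alpha> k \<bullet> \<alpha> k) / 2 else 0))"
      unfolding y inner_sum_left inner_scaleR_left by (intro sum.cong refl) (simp only: d)
    also have "\<dots> = c (\<alpha> k) * ((\<alpha> k \<bullet> \<alpha> k) / 2)"
      using fin k by (simp add: if_distrib[where f="\<lambda>x. _ * x"] cong: if_cong)
    finally have a: "y \<bullet> fundamental_weight \<alpha> I k = c (\<alpha> k) * ((\<alpha> k \<bullet> \<alpha> k) / 2)" .
    have b: "sol u I k = 2 / (\<alpha> k \<bullet> \<alpha> k) * (y \<bullet> fundamental_weight \<alpha> I k)"
      by (simp add: sol_def y_def inner_sum_left)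
    show ?thesis unfolding b a using nz by simp
  qed
  then have "(\<Sum>k\<in>I. sol u I k * (\<alpha> k \<bullet> coroot (\<alpha> j))) = y \<bullet> coroot (\<alpha> j)"
    unfolding y inner_sum_left inner_scaleR_left by (intro sum.cong) auto
  also have "\<dots> = (\<Sum>i\<in>I. u i * (if i = j then 1 else 0))"
    unfolding y_def inner_sum_left inner_scaleR_left by (intro sum.cong refl) (simp only: dual(2)[OF _ j])
  also have "\<dots> = u j" using fin j by (simp add: if_distrib[where f="\<lambda>x. _ * x"] cong: if_cong)
  finally show ?thesis .
qed

lemma cartan_nonneg:
  assumes J: "J \<subseteq> {1..n}" and c: "\<And>j. j \<in> J \<Longrightarrow> 0 \<le> (\<Sum>k\<in>J. c k * (\<alpha> k \<bullet> coroot (\<alpha> j)))" and k: "k \<in> J"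
  shows "0 \<le> c k"
proof (rule obtuse_nonneg[OF J _ k])
  fix j assume j: "j \<in> J"
  have "0 < \<alpha> j \<bullet> \<alpha> j" using simple_nz j J by auto
  moreover have "(\<Sum>k\<in>J. c k * (\<alpha> k \<bullet> coroot (\<alpha> j))) = 2 / (\<alpha> j \<bullet> \<alpha> j) * (\<Sum>k\<in>J. c k * (\<alpha> k \<bullet> \<alpha> j))"
    by (simp add: coroot_def sum_distrib_left mult_ac)
  ultimately show "0 \<le> (\<Sum>k\<in>J. c k * (\<alpha> k \<bullet> \<alpha> j))"
    using c[OF j] by (simp add: zero_le_mult_iff zero_le_divide_iff del: inner_gt_zero_iff)
qed

text \<open>The Cartan entries between \<open>C\<close> and \<open>I - C\<close> vanish, so the
  solution for \<open>I\<close> also solves the system of \<open>C\<close>;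
  \<open>cartan_nonneg\<close> applied to both differences gives uniqueness.\<close>

lemma sol_component:
  assumes I: "I \<subseteq> {1..n}" and C: "C \<subseteq> I" and k: "k \<in> C"
    and orth: "\<And>a b. a \<in> C \<Longrightarrow> b \<in> I - C \<Longrightarrow> \<alpha> a \<bullet> \<alpha> b = 0"
  shows "sol u C k = sol u I k"
proof -
  have fin: "finite I" using I finite_subset by blast
  have CN: "C \<subseteq> {1..n}" using C I by blast
  have eq: "(\<Sum>k\<in>C. sol u I k * (\<alpha> k \<bullet> coroot (\<alpha> j))) = u j" if j: "j \<in> C" for j
  proof -
    have "(\<Sum>k\<in>I - C. sol u I k * (\<alpha> k \<bullet> coroot (\<alpha> j))) = 0"
      using orth[OF j] by (intro sum.neutral) (auto simp: coroot_def inner_commute)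
    then show ?thesis
      using sol_solution[OF I, of j u] j C sum.subset_diff[OF C fin, of "\<lambda>k. sol u I k * (\<alpha> k \<bullet> coroot (\<alpha> j))"] by auto
  qed
  have "0 \<le> sol u I k - sol u C k"
    by (rule cartan_nonneg[OF CN _ k]) (simp add: left_diff_distrib sum_subtractf eq sol_solution[OF CN])
  moreover have "0 \<le> sol u C k - sol u I k"
    by (rule cartan_nonneg[OF CN _ k]) (simp add: left_diff_distrib sum_subtractf eq sol_solution[OF CN])
  ultimately show ?thesis by simp
qed

lemma obtuse_system_cartan:
  assumes "\<And>j. j \<in> {1..n} \<Longrightarrow> 0 \<le> u j"
  shows "obtuse_system {1..n} (\<lambda>k j. \<alpha> k \<bullet> coroot (\<alpha> j)) u (sol u)"
proof
  fix k j assume "k \<in> {1..n}" "j \<in> {1..n}" "k \<noteq> j"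
  then show "\<alpha> k \<bullet> coroot (\<alpha> j) \<le> 0"
    using simple_obtuse[of k j] by (simp add: coroot_def divide_nonpos_nonneg)
next
  fix J c k assume "J \<subseteq> {1..n}" "\<And>j. j \<in> J \<Longrightarrow> 0 \<le> (\<Sum>k\<in>J. c k * (\<alpha> k \<bullet> coroot (\<alpha> j)))" "k \<in> J"
  then show "0 \<le> (c k :: real)" by (rule cartan_nonneg)
qed (use assms sol_solution in auto)

text \<open>Both sides obey the same recursion over index sets. Nonnegativity is carried along
  because \<open>ennreal\<close> truncates negative values to 0.\<close>

lemma volume_eq_forest_sum:
  fixes u :: "nat \<Rightarrow> real"
  assumes u: "\<And>j. j \<in> {1..n} \<Longrightarrow> 0 \<le> u j" and I: "I \<subseteq> {1..n}"
  defines "F \<equiv> \<lambda>C j. 2 / (\<alpha> j \<bullet> \<alpha> j) * tree_factor \<alpha> C j u"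
  shows "0 \<le> sym_graph.forest_sum (dynkin_adj \<alpha>) F I \<and>
    emeasure (PiM I (\<lambda>_. lborel)) (obtuse_system.Q (\<lambda>k j. \<alpha> k \<bullet> coroot (\<alpha> j)) u I) =
      ennreal (sym_graph.forest_sum (dynkin_adj \<alpha>) F I)"
proof -
  interpret G: sym_graph "dynkin_adj \<alpha>"
    by standard (simp add: dynkin_adj_def inner_commute)
  interpret O: obtuse_system "{1..n}" "\<lambda>k j. \<alpha> k \<bullet> coroot (\<alpha> j)" u "sol u"
    using u by (rule obtuse_system_cartan)
  \<comment> \<open>The component size from \<open>forest_sum_rec\<close> cancels the reciprocal
    cardinality in \<open>tree_factor\<close>, leaving the apex coordinate of
    \<open>volume_rec\<close>.\<close>
  have factor: "real (card (G.comp I r)) * F (G.comp I r) r = sol u I r"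
    if I: "I \<subseteq> {1..n}" and r: "r \<in> I" for I r
  proof -
    let ?C = "G.comp I r"
    have C: "?C \<subseteq> I" "r \<in> ?C" using G.comp_subset[OF r] G.comp_self by blast+
    have "finite ?C" using C I by (meson finite_atLeastAtMost finite_subset)
    then have "card ?C \<noteq> 0" using C by auto
    then have "real (card ?C) * F ?C r = sol u ?C r"
      by (simp add: F_def tree_factor_def sol_def)
    also have "\<dots> = sol u I r"
    proof (rule sol_component[OF I C])
      fix a b assume ab: "a \<in> ?C" "b \<in> I - ?C"
      then have "a \<in> I" "b \<in> I" "b \<noteq> a" "b \<notin> ?C" using C by auto
      then show "\<alpha> a \<bullet> \<alpha> b = 0"
        using G.comp_closed[OF ab(1), of b] by (metis dynkin_adj_def inner_commute)
    qed
    finally show ?thesis .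
  qed
  have "0 \<le> G.forest_sum F I \<and> emeasure (O.M I) (O.Q I) = ennreal (G.forest_sum F I)"
    using I
  proof (induction "card I" arbitrary: I rule: less_induct)
    case less
    have fin: "finite I" using less.prems finite_subset by blast
    show ?case
    proof (cases "I = {}")
      case True
      then show ?thesis by (simp add: G.forest_sum_empty O.volume_empty)
    next
      case False
      then have c: "0 < real (card I)" using fin by (simp add: card_gt_0_iff)
      have IH: "0 \<le> G.forest_sum F (I - {i})"
        "emeasure (O.M (I - {i})) (O.Q (I - {i})) = ennreal (G.forest_sum F (I - {i}))" if i: "i \<in> I" for i
        using less.hyps[of "I - {i}"] less.prems card_Diff1_less[OF fin i] by auto
      have z: "0 \<le> sol u I i" if "i \<in> I" for i using O.z_nonneg[OF less.prems that] .
      have rec: "real (card I) * G.forest_sum F I = (\<Sum>i\<in>I. sol u I i * G.forest_sum F (I - {i}))"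
        unfolding G.forest_sum_rec[OF fin] using factor[OF less.prems] by (intro sum.cong) auto
      have "0 \<le> real (card I) * G.forest_sum F I"
        unfolding rec using IH(1) z by (intro sum_nonneg mult_nonneg_nonneg)
      then have nn: "0 \<le> G.forest_sum F I" using c by (simp add: zero_le_mult_iff)
      have "ennreal (real (card I)) * emeasure (O.M I) (O.Q I) =
          (\<Sum>i\<in>I. ennreal (sol u I i) * ennreal (G.forest_sum F (I - {i})))"
        using O.volume_rec[OF less.prems] IH(2) by (simp add: ennreal_of_nat_eq_real_of_nat)
      also have "\<dots> = (\<Sum>i\<in>I. ennreal (sol u I i * G.forest_sum F (I - {i})))"
        using z IH(1) by (intro sum.cong refl) (simp add: ennreal_mult)
      also have "\<dots> = ennreal (real (card I) * G.forest_sum F I)"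
        unfolding rec using z IH(1) by (intro sum_ennreal mult_nonneg_nonneg)
      also have "\<dots> = ennreal (real (card I)) * ennreal (G.forest_sum F I)"
        using c nn by (simp add: ennreal_mult)
      finally have "emeasure (O.M I) (O.Q I) = ennreal (G.forest_sum F I)"
        using c by (simp add: ennreal_mult_cancel_left)
      then show ?thesis using nn by blast
    qed
  qed
  then show ?thesis .
qed

lemma root_volume_polytope:
  fixes u :: "nat \<Rightarrow> real"
  assumes irr: "irreducible_root_system \<Phi>" and u: "\<And>j. j \<in> {1..n} \<Longrightarrow> 0 \<le> u j"
    and x: "x = (\<Sum>i=1..n. u i *\<^sub>R fundamental_weight \<alpha> {1..n} i)"
  shows "root_volume n \<alpha> (weight_polytope \<Phi> x) =
    2 ^ n * real (card W) / (\<Prod>i=1..n. \<alpha> i \<bullet> \<alpha> i) *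
      (\<Sum>T\<in>{T. Phi_tree n \<alpha> T}. \<Prod>j=1..n. tree_factor \<alpha> (desc j T) j u)"
proof -
  interpret G: sym_graph "dynkin_adj \<alpha>"
    by standard (simp add: dynkin_adj_def inner_commute)
  interpret O: obtuse_system "{1..n}" "\<lambda>k j. \<alpha> k \<bullet> coroot (\<alpha> j)" u "sol u"
    using u by (rule obtuse_system_cartan)
  define F where "F C j = 2 / (\<alpha> j \<bullet> \<alpha> j) * tree_factor \<alpha> C j u" for C j
  let ?fs = "G.forest_sum F {1..n}"
  let ?P = "weight_polytope \<Phi> x" and ?D = "weight_polytope \<Phi> x \<inter> {v. dom v}"
  have xc: "x \<bullet> coroot (\<alpha> j) = u j" if j: "j \<in> {1..n}" for j
  proof -
    have "x \<bullet> coroot (\<alpha> j) = (\<Sum>i=1..n. u i * (if i = j then 1 else 0))"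
      unfolding x inner_sum_left inner_scaleR_left
      by (intro sum.cong refl) (simp only: fundamental_weight_dual(2)[OF inj_simple indep_simple _ j])
    also have "\<dots> = u j" using j by (simp add: if_distrib[where f="\<lambda>x. _ * x"] cong: if_cong)
    finally show ?thesis .
  qed
  have dom_iff: "dom v \<longleftrightarrow> (\<forall>j\<in>{1..n}. 0 \<le> v \<bullet> coroot (\<alpha> j))" for v
  proof -
    have "0 \<le> v \<bullet> coroot (\<alpha> j) \<longleftrightarrow> 0 \<le> v \<bullet> \<alpha> j" if "j \<in> {1..n}" for j
    proof -
      have "0 < \<alpha> j \<bullet> \<alpha> j" using simple_nz[OF that] by simp
      then show ?thesis by (simp add: coroot_def zero_le_divide_iff zero_le_mult_iff del: inner_gt_zero_iff)
    qed
    then show ?thesis by (simp add: dom_def)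
  qed
  have xd: "dom x" unfolding dom_iff using xc u by simp
  \<comment> \<open>In the coordinates of x - y the dominance order reads
    \<open>0 \<le> p k\<close>, and dominance of y becomes the constraints by
    \<open>u\<close>.\<close>
  have Q: "lin -` {v. x - v \<in> ?D} \<inter> space cube = O.Q {1..n}"
  proof -
    have "x - lin p \<in> ?D \<longleftrightarrow> (\<forall>k\<in>{1..n}. 0 \<le> p k) \<and>
        (\<forall>j\<in>{1..n}. (\<Sum>k=1..n. p k * (\<alpha> k \<bullet> coroot (\<alpha> j))) \<le> u j)" for p
    proof -
      have e1: "(x - lin p) \<bullet> coweight k \<le> x \<bullet> coweight k \<longleftrightarrow> 0 \<le> p k" if "k \<in> {1..n}" for k
        unfolding inner_diff_left coweight_sum[OF that] by simp
      have e2: "0 \<le> (x - lin p) \<bullet> coroot (\<alpha> j) \<longleftrightarrow> (\<Sum>k=1..n. p k * (\<alpha> k \<bullet> coroot (\<alpha> j))) \<le> u j"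
        if "j \<in> {1..n}" for j
        unfolding inner_diff_left xc[OF that] inner_sum_left inner_scaleR_left by simp
      have "x - lin p \<in> ?D \<longleftrightarrow> (\<forall>k\<in>{1..n}. (x - lin p) \<bullet> coweight k \<le> x \<bullet> coweight k) \<and>
          (\<forall>j\<in>{1..n}. 0 \<le> (x - lin p) \<bullet> coroot (\<alpha> j))"
        unfolding Int_iff mem_Collect_eq polytope_dom_iff[OF xd] unfolding dom_iff[of "x - lin p"]
        by (rule conj_commute)
      then show ?thesis by (simp only: e1 e2 cong: ball_cong)
    qed
    then show ?thesis unfolding O.Q_def by auto
  qed
  have D: "?D \<in> sets borel" using closed_polytope closed_dom by (intro borel_closed closed_Int)
  have D': "{v. x - v \<in> ?D} \<in> sets borel"
  proof -
    have "(\<lambda>v. x - v) -` ?D \<inter> space borel \<in> sets borel" by (rule measurable_sets[OF _ D]) simp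
    then show ?thesis by (simp add: vimage_def)
  qed
  have "emeasure lborel ?D = (\<integral>\<^sup>+v. indicator ?D v \<partial>lborel)" using D by simp
  also have "\<dots> = (\<integral>\<^sup>+v. indicator ?D (x - v) \<partial>lborel)"
    using D by (intro nn_integral_lborel_reflect[symmetric]) simp
  also have "\<dots> = (\<integral>\<^sup>+v. indicator {v. x - v \<in> ?D} v \<partial>lborel)"
    by (intro nn_integral_cong) (auto simp: indicator_def)
  also have "\<dots> = emeasure lborel {v. x - v \<in> ?D}" using D' by simp
  also have "\<dots> = emeasure (O.M {1..n}) (O.Q {1..n}) * emeasure lborel (root_parallelepiped n \<alpha>)"
    by (simp only: emeasure_lborel_lin[OF D'] Q)
  finally have eD: "emeasure lborel ?D = ennreal ?fs * emeasure lborel (root_parallelepiped n \<alpha>)"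
    using volume_eq_forest_sum[OF u subset_refl] by (simp add: F_def[abs_def])
  have fs: "0 \<le> ?fs" using volume_eq_forest_sum[OF u subset_refl] by (simp add: F_def[abs_def])
  have "emeasure lborel ?P = ennreal (real (card W) * ?fs) * emeasure lborel (root_parallelepiped n \<alpha>)"
    unfolding emeasure_polytope[of x] eD using fs by (simp add: ennreal_mult ennreal_of_nat_eq_real_of_nat mult.assoc)
  then have "root_volume n \<alpha> ?P = real (card W) * ?fs"
    using fs closed_polytope by (intro root_volume_eq) (auto intro: borel_closed)
  also have "?fs = (\<Sum>T\<in>{T. G.connected_tree {1..n} T}. \<Prod>j=1..n. F (desc j T) j)"
    using G.sum_connected_trees[OF _ conn_dynkin[OF irr]] by simp
  also have "{T. G.connected_tree {1..n} T} = {T. Phi_tree n \<alpha> T}"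
    by (simp add: G.connected_tree_def Phi_tree_def)
  \<comment> \<open>The n factors 2/(\<alpha> j, \<alpha> j) in \<open>F\<close> do not depend on
    the tree, so their product leaves the sum.\<close>
  also have "(\<Sum>T\<in>{T. Phi_tree n \<alpha> T}. \<Prod>j=1..n. F (desc j T) j) =
      2 ^ n / (\<Prod>i=1..n. \<alpha> i \<bullet> \<alpha> i) * (\<Sum>T\<in>{T. Phi_tree n \<alpha> T}. \<Prod>j=1..n. tree_factor \<alpha> (desc j T) j u)"
    by (simp add: F_def prod.distrib prod_dividef sum_distrib_left)
  finally show ?thesis by simp
qed

end

theorem theorem18p3:
  fixes \<Phi> :: "'a::euclidean_space set" and n :: nat
    and \<alpha> \<omega> :: "nat \<Rightarrow> 'a" and u :: "nat \<Rightarrow> real" and x :: 'a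
  assumes irr: "irreducible_root_system \<Phi>"
    and rank: "DIM('a) = n"
    and simple: "simple_roots \<Phi> n \<alpha>"
    and weights: "\<forall>i\<in>{1..n}. \<omega> i = fundamental_weight \<alpha> {1..n} i"
    and nonneg: "\<forall>i\<in>{1..n}. u i \<ge> 0"
    and x: "x = (\<Sum>i=1..n. u i *\<^sub>R \<omega> i)"
  shows "root_volume n \<alpha> (weight_polytope \<Phi> x) =
    2 ^ n * real (card (weyl_group \<Phi>)) / (\<Prod>i=1..n. \<alpha> i \<bullet> \<alpha> i) *
      (\<Sum>T\<in>{T. Phi_tree n \<alpha> T}. \<Prod>j=1..n. tree_factor \<alpha> (desc j T) j u)"
proof -
  interpret simple_system \<Phi> n \<alpha>
    using irr rank simple by unfold_locales (simp_all add: irreducible_root_system_def)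
  show ?thesis
    using weights nonneg by (intro root_volume_polytope[OF irr]) (auto simp: x intro: sum.cong)
qed

end
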